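(* Let $\mathbb F$ be a field of characteristic $p>n$ or $p=0$, let $G$ be a subgroup of $B_n$, and let $0\le k\le n$. Then: (i) $M^G_k=\bigoplus_{j,i}E^G_{k,j,i}$, the sum over $0\le j\le k$ and $0\le i\le\min\{k-j,n-k\}$. (ii) For every $0\le j\le n$ and $0\le i\le n-j$, the maps $\epsilon$ and $\partial$ restrict to isomorphisms $$E^G_{j+i,j,i}\longleftrightarrow E^G_{j+i+1,j,i}\longleftrightarrow\cdots\longleftrightarrow E^G_{n-i,j,i}$$ (i.e. $\epsilon:E^G_{s,j,i}\to E^G_{s+1,j,i}$ and $\partial:E^G_{s+1,j,i}\to E^G_{s,j,i}$ are isomorphisms for $j+i\le s<n-i$), while $\partial(E^G_{j+i,j,i})=0=\epsilon(E^G_{n-i,j,i})$.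
   Context: Let $V=\{\alpha_1,\bar\alpha_1,\dots,\alpha_n,\bar\alpha_n\}$ be a set of $2n$ distinct elements, with $\bar{\bar\alpha}_i=\alpha_i$. For $0\le k\le n$, $L^n_k$ is the set of $k$-element subsets $x\subseteq V$ with $|x\cap\{\alpha_i,\bar\alpha_i\}|\le1$ for all $i$; $M^n_k$ is the $\mathbb F$-vector space with basis $L^n_k$ ($M^n_k=0$ if $k<0$ or $k>n$), $M^n=\bigoplus_kM^n_k$. Elements are written as polynomials in the vertices: a product of distinct vertices forming such a set denotes that set, extended bilinearly. Linear maps $\epsilon,\partial$ on $x\in L^n_k$: $\epsilon(x)=\sum_{y\in L^n_{k+1},\,y\supset x}y$, $\partial(x)=\sum_{z\in L^n_{k-1},\,z\subset x}z$; $\nu^+_k=\partial\epsilon$ restricted to $M^n_k$. Let $\dot V=\{\alpha_1,\dots,\alpha_n\}$; for disjoint $a,b\subseteq\dot V$, $[a,b]=\prod_{\alpha\in a}(\alpha+\bar\alpha)\prod_{\beta\in b}(\beta-\bar\beta)$, $[\emptyset,\emptyset]=\emptyset$. $E_{k,j}$ is the span of all $[a,b]$ with $a,b$ disjoint, $|a|=k-j$, $|b|=j$; it is $\nu^+_k$-invariant, and $E_{k,j,i}$ is the eigenspace of $\nu^+_k|_{E_{k,j}}$ for the eigenvalue $2(k-j+1-i)(n-k-i)$. The hyperoctahedral group $B_n$ is the group of permutations $g$ of $V$ with $\bar\beta^g=\overline{\beta^g}$ for all $\beta$, acting on faces by $x^g=\{\beta^g:\beta\in x\}$ and linearly on $M^n$;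 the $E_{k,j,i}$ are $B_n$-invariant. For a $G$-invariant subspace $N$, $N^G=\{f\in N: f^g=f\ \forall g\in G\}$, and $M^G_k:=(M^n_k)^G$.
   Formalization: The case n = 1, p = 2 is excluded: it satisfies p > n, but there α − ᾱ = α + ᾱ, so E_{1,0,0} = E_{1,1,0} and the sum in (i) is not direct, and ∂ vanishes on E_{1,0,0}, so (ii) fails too. *)

theory Defs
  imports
    "HOL-Algebra.Group"
    "HOL-Combinatorics.Permutations"
    "HOL-Computational_Algebra.Computational_Algebra"
    "HOL-Library.Function_Algebras"
begin

section \<open>Faces of the cross-polytope\<close>

datatype vertex = Alpha nat | Alpha_bar nat

primrec bar :: "vertex \<Rightarrow> vertex" where
  "bar (Alpha i) = Alpha_bar i"
| "bar (Alpha_bar i) = Alpha i"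

definition Vdot :: "nat \<Rightarrow> vertex set" where
  "Vdot n = Alpha ` {1..n}"

definition V :: "nat \<Rightarrow> vertex set" where
  "V n = Vdot n \<union> bar ` Vdot n"

definition L :: "nat \<Rightarrow> nat \<Rightarrow> vertex set set" where
  "L n k = {x. x \<subseteq> V n \<and> card x = k \<and> (\<forall>\<alpha>\<in>Vdot n. card (x \<inter> {\<alpha>, bar \<alpha>}) \<le> 1)}"

definition faces :: "nat \<Rightarrow> vertex set set" where
  "faces n = (\<Union>k\<le>n. L n k)"


section \<open>The vector space spanned by the faces\<close>

text \<open>
  A formal linear combination of sets of vertices is its coefficient function; addition is the
  pointwise one of \<^theory>\<open>HOL-Library.Function_Algebras\<close>. The pointwise product provided by that
  theory is not used: the product of polynomials in the vertices is \<open>chain_mult\<close> below.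
\<close>

type_synonym 'a chain = "vertex set \<Rightarrow> 'a"

definition scale :: "'a::field \<Rightarrow> 'a chain \<Rightarrow> 'a chain" where
  "scale c f = (\<lambda>x. c * f x)"

global_interpretation chain: vector_space "scale :: 'a::field \<Rightarrow> 'a chain \<Rightarrow> 'a chain"
  by standard (simp_all add: scale_def fun_eq_iff algebra_simps)

definition face :: "vertex set \<Rightarrow> 'a::field chain" where
  "face x = (\<lambda>y. if y = x then 1 else 0)"

definition M :: "nat \<Rightarrow> nat \<Rightarrow> 'a::field chain set" where
  "M n k = {f. \<forall>x. f x \<noteq> 0 \<longrightarrow> x \<in> L n k}"

text \<open>Linear extension of a map given on the basis of faces.\<close>

definition lin_ext :: "nat \<Rightarrow> (vertex set \<Rightarrow> 'a chain) \<Rightarrow> 'a chain \<Rightarrow> 'a::field chain" where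
  "lin_ext n \<phi> f = (\<Sum>x\<in>faces n. scale (f x) (\<phi> x))"

definition eps :: "nat \<Rightarrow> 'a chain \<Rightarrow> 'a::field chain" where
  "eps n = lin_ext n (\<lambda>x. \<Sum>y | y \<in> L n (card x + 1) \<and> x \<subset> y. face y)"

definition bd :: "nat \<Rightarrow> 'a chain \<Rightarrow> 'a::field chain" where
  "bd n = lin_ext n (\<lambda>x. \<Sum>z | z \<in> faces n \<and> card z + 1 = card x \<and> z \<subset> x. face z)"

definition nu_plus :: "nat \<Rightarrow> 'a chain \<Rightarrow> 'a::field chain" where
  "nu_plus n f = bd n (eps n f)"


section \<open>Products of polynomials in the vertices\<close>

text \<open>
  The bilinear extension of \<open>x \<cdot> y = x \<union> y\<close> for disjoint finite \<open>x\<close>, \<open>y\<close>. Products of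
  non-disjoint sets get the value 0; they do not occur in the elements \<open>[a,b]\<close>.
\<close>

definition chain_mult :: "'a chain \<Rightarrow> 'a chain \<Rightarrow> 'a::field chain" where
  "chain_mult f g = (\<lambda>z. \<Sum>x\<in>Pow z. f x * g (z - x))"

lemma chain_mult_face:
  assumes "finite x" "finite y"
  shows "chain_mult (face x) (face y) = (if x \<inter> y = {} then face (x \<union> y) else (0 :: 'a::field chain))"
proof (rule ext)
  fix z
  have eq: "face x u * face y (z - u) = (if u = x then (if z - x = y then 1 else 0) else (0::'a))" for u
    by (simp add: face_def)
  show "chain_mult (face x) (face y) z = (if x \<inter> y = {} then face (x \<union> y) else (0 :: 'a chain)) z"
  proof (cases "finite z")
    case True
    then have "chain_mult (face x) (face y) z
        = (if x \<subseteq> z \<and> z - x = y then 1 else (0::'a))"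
      unfolding chain_mult_def eq by (simp add: sum.delta)
    moreover have "x \<subseteq> z \<and> z - x = y \<longleftrightarrow> x \<inter> y = {} \<and> z = x \<union> y"
      by blast
    ultimately show ?thesis
      by (simp add: face_def)
  next
    case False
    moreover from this have "z \<noteq> x \<union> y"
      using assms by auto
    ultimately show ?thesis
      by (simp add: chain_mult_def face_def)
  qed
qed

lemma chain_mult_left_commute:
  fixes f g h :: "'a::field chain"
  shows "chain_mult f (chain_mult g h) = chain_mult g (chain_mult f h)"
proof (rule ext)
  fix z
  have expand: "chain_mult p (chain_mult q h) z
      = (\<Sum>(x, y)\<in>Sigma (Pow z) (\<lambda>x. Pow (z - x)). p x * (q y * h (z - x - y)))"
    if "finite z" for p q :: "'a chain"
    using that by (simp add: chain_mult_def sum_distrib_left sum.Sigma)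
  show "chain_mult f (chain_mult g h) z = chain_mult g (chain_mult f h) z"
  proof (cases "finite z")
    case True
    have "(\<Sum>(x, y)\<in>Sigma (Pow z) (\<lambda>x. Pow (z - x)). f x * (g y * h (z - x - y)))
        = (\<Sum>(x, y)\<in>Sigma (Pow z) (\<lambda>x. Pow (z - x)). g x * (f y * h (z - x - y)))"
      by (rule sum.reindex_bij_witness[where i = prod.swap and j = prod.swap])
        (auto simp: algebra_simps Diff_eq Int_assoc Int_commute Int_left_commute)
    then show ?thesis
      by (simp add: expand True)
  next
    case False
    then show ?thesis
      by (simp add: chain_mult_def)
  qed
qed

definition chain_prod :: "(vertex \<Rightarrow> 'a chain) \<Rightarrow> vertex set \<Rightarrow> 'a::field chain" where
  "chain_prod F A = Finite_Set.fold (\<lambda>v. chain_mult (F v)) (face {}) A"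

lemma chain_prod_empty [simp]: "chain_prod F {} = face {}"
  by (simp add: chain_prod_def)

lemma chain_prod_insert [simp]:
  assumes "finite A" "v \<notin> A"
  shows "chain_prod F (insert v A) = chain_mult (F v) (chain_prod F A)"
proof -
  interpret comp_fun_commute "\<lambda>v. chain_mult (F v)"
    by standard (simp add: fun_eq_iff chain_mult_left_commute)
  show ?thesis
    using assms by (simp add: chain_prod_def)
qed

definition bracket :: "vertex set \<Rightarrow> vertex set \<Rightarrow> 'a::field chain" where
  "bracket a b =
     chain_mult (chain_prod (\<lambda>\<alpha>. face {\<alpha>} + face {bar \<alpha>}) a)
                (chain_prod (\<lambda>\<beta>. face {\<beta>} - face {bar \<beta>}) b)"

definition E2 :: "nat \<Rightarrow> nat \<Rightarrow> nat \<Rightarrow> 'a::field chain set" where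
  "E2 n k j = chain.span {bracket a b | a b.
     a \<subseteq> Vdot n \<and> b \<subseteq> Vdot n \<and> a \<inter> b = {} \<and> int (card a) = int k - int j \<and> card b = j}"

text \<open>The eigenvalue is computed in the integers: its factors may be negative when \<open>i\<close> is large.\<close>

definition E3 :: "nat \<Rightarrow> nat \<Rightarrow> nat \<Rightarrow> nat \<Rightarrow> 'a::field chain set" where
  "E3 n k j i = {f \<in> E2 n k j.
     nu_plus n f = scale (of_int (2 * (int k - int j + 1 - int i) * (int n - int k - int i))) f}"


section \<open>The hyperoctahedral group\<close>

text \<open>Permutations act on the right, so the product of \<open>g\<close> and \<open>h\<close> is \<open>g\<close> followed by \<open>h\<close>.\<close>

definition hyperoct :: "nat \<Rightarrow> (vertex \<Rightarrow> vertex) monoid" where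
  "hyperoct n = \<lparr>carrier = {g. g permutes V n \<and> (\<forall>\<beta>\<in>V n. g (bar \<beta>) = bar (g \<beta>))},
                 monoid.mult = (\<lambda>g h. h \<circ> g), one = id\<rparr>"

lemma group_hyperoct: "group (hyperoct n)"
proof (rule groupI)
  fix g assume g: "g \<in> carrier (hyperoct n)"
  have com: "g (bar \<beta>) = bar (g \<beta>)" if "\<beta> \<in> V n" for \<beta>
    using g that by (auto simp: hyperoct_def)
  have p: "g permutes V n" using g by (simp add: hyperoct_def)
  have "inv_into UNIV g (bar \<beta>) = bar (inv_into UNIV g \<beta>)" if "\<beta> \<in> V n" for \<beta>
    using com[of "inv_into UNIV g \<beta>"] that permutes_inverses[OF p] permutes_in_image[OF permutes_inv[OF p]]
    by metis
  then have "inv_into UNIV g \<in> carrier (hyperoct n)"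
    using permutes_inv[OF p] by (simp add: hyperoct_def)
  moreover have "inv_into UNIV g \<otimes>\<^bsub>hyperoct n\<^esub> g = \<one>\<^bsub>hyperoct n\<^esub>"
    using permutes_inv_o(1)[OF p] by (simp add: hyperoct_def)
  ultimately show "\<exists>h\<in>carrier (hyperoct n). h \<otimes>\<^bsub>hyperoct n\<^esub> g = \<one>\<^bsub>hyperoct n\<^esub>"
    by blast
qed (auto simp: hyperoct_def permutes_id permutes_in_image intro: permutes_compose)

definition act :: "nat \<Rightarrow> (vertex \<Rightarrow> vertex) \<Rightarrow> 'a chain \<Rightarrow> 'a::field chain" where
  "act n g = lin_ext n (\<lambda>x. face (g ` x))"

definition fixed :: "nat \<Rightarrow> (vertex \<Rightarrow> vertex) set \<Rightarrow> 'a::field chain set \<Rightarrow> 'a chain set" where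
  "fixed n G N = {f \<in> N. \<forall>g\<in>G. act n g f = f}"


section \<open>Direct sums and isomorphisms of subspaces\<close>

definition is_direct_sum :: "'i set \<Rightarrow> ('i \<Rightarrow> 'a chain set) \<Rightarrow> 'a::field chain set \<Rightarrow> bool" where
  "is_direct_sum I N W \<longleftrightarrow>
     (\<forall>t\<in>I. chain.subspace (N t)) \<and>
     W = {\<Sum>t\<in>I. v t | v. \<forall>t\<in>I. v t \<in> N t} \<and>
     (\<forall>v. (\<forall>t\<in>I. v t \<in> N t) \<and> (\<Sum>t\<in>I. v t) = 0 \<longrightarrow> (\<forall>t\<in>I. v t = 0))"

definition restricts_to_iso ::
    "('a chain \<Rightarrow> 'a chain) \<Rightarrow> 'a::field chain set \<Rightarrow> 'a chain set \<Rightarrow> bool" where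
  "restricts_to_iso \<phi> U W \<longleftrightarrow>
     Vector_Spaces.linear scale scale \<phi> \<and> chain.subspace U \<and> chain.subspace W \<and> bij_betw \<phi> U W"

end

theory Submission
  imports Defs
begin

text \<open>
  Let \<open>T\<close> be the sum over \<open>i\<close> of the operators exchanging \<open>\<alpha>\<^sub>i\<close> with its antipode. On \<open>M n k\<close> one has
  \<open>\<partial>\<epsilon> - \<epsilon>\<partial> = 3n - 4k - T\<close>, so \<open>T\<close> commutes with the hyperoctahedral group, with \<open>\<epsilon>\<close> and
  with \<open>\<partial>\<close>. Since \<open>T [a,b] = (n - 2|b|) [a,b]\<close> and the brackets span, \<open>E2 n k j\<close> is the
  eigenspace of \<open>T\<close> on \<open>M n k\<close> for the eigenvalue \<open>n - 2j\<close>. There \<open>\<partial>\<epsilon> - \<epsilon>\<partial>\<close> is the scalar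
  \<open>2(n + j - 2k)\<close>, and the rest is an \<open>sl\<^sub>2\<close> argument: \<open>\<epsilon>\<close> and \<open>\<partial>\<close> exchange \<open>E3 n s j i\<close> and
  \<open>E3 n (s + 1) j i\<close> with a scalar composite that is invertible in the stated range. Uniqueness of the
  eigenspace decomposition makes its components invariant whenever the sum is.
\<close>

section \<open>Faces\<close>

text \<open>The delicate point is that the eigenvalue of \<open>nu_plus\<close> does not determine
  the label i: for fixed k and j it takes the same value at i and at n - j + 1 - i. Two labels are
  told apart only while i + i' \<le> n - j. The labels i \<le> min (k - j) (n - k) satisfy this
  bound, and so do the comparisons that make \<open>bd\<close> and \<open>eps\<close> vanish at the
  ends of a chain of isomorphisms. The characteristic enters through one condition: 2x is nonzero in
  the field for 0 < x \<le> n. The scalars divided by, and the differences of eigenvalues that must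
  be nonzero, are up to sign products of factors x or 2x in this range. For n = 1 and characteristic
  2 the condition p > n holds but the decomposition fails: \<alpha> + \<open>bar \<alpha>\<close>
  and \<alpha> - \<open>bar \<alpha>\<close> coincide, so the brackets span only a line in the plane
  \<open>M 1 1\<close>. This is the case that \<open>not_degenerate\<close> excludes.\<close>

lemma bar_bar [simp]: "bar (bar v) = v"
  by (cases v) auto

lemma bar_neq [simp]: "bar v \<noteq> v" "v \<noteq> bar v"
  by (cases v; auto)+

lemma bar_eq_iff [simp]: "bar u = bar v \<longleftrightarrow> u = v"
  by (metis bar_bar)

lemma bar_in_V [simp]: "bar v \<in> V n \<longleftrightarrow> v \<in> V n"
  by (auto simp: V_def) (metis bar_bar imageI)

lemma bar_Vdot: "\<alpha> \<in> Vdot n \<Longrightarrow> bar \<alpha> \<notin> Vdot n"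
  by (auto simp: Vdot_def)

lemma finite_Vdot [simp]: "finite (Vdot n)"
  by (simp add: Vdot_def)

lemma card_Vdot [simp]: "card (Vdot n) = n"
  by (simp add: Vdot_def card_image inj_on_def)

lemma finite_V [simp]: "finite (V n)"
  by (simp add: V_def)

lemma card_V: "card (V n) = 2 * n"
proof -
  have "Vdot n \<inter> bar ` Vdot n = {}"
    by (auto simp: Vdot_def)
  then have "card (V n) = card (Vdot n) + card (bar ` Vdot n)"
    unfolding V_def by (intro card_Un_disjoint) auto
  also have "card (bar ` Vdot n) = n"
    by (subst card_image) (auto simp: inj_on_def)
  finally show ?thesis by simp
qed

text \<open>For a face x these are exactly the vertices whose addition gives a larger face: both
  vertices of every antipodal pair that x misses.\<close>

definition free :: "nat \<Rightarrow> vertex set \<Rightarrow> vertex set" where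
  "free n x = {v \<in> V n. v \<notin> x \<and> bar v \<notin> x}"

lemma finite_free [simp]: "finite (free n x)"
  by (simp add: free_def)

lemma card_free:
  assumes "x \<subseteq> V n" "\<And>v. v \<in> x \<Longrightarrow> bar v \<notin> x"
  shows "card (free n x) + 2 * card x = 2 * n"
proof -
  have fin: "finite x" using assms(1) finite_V finite_subset by blast
  have "V n = free n x \<union> (x \<union> bar ` x)"
    using assms(1) by (auto simp: free_def) (metis bar_bar imageI)
  moreover have "card (free n x \<union> (x \<union> bar ` x)) = card (free n x) + card (x \<union> bar ` x)"
    using fin by (intro card_Un_disjoint) (auto simp: free_def)
  moreover have "card (x \<union> bar ` x) = card x + card (bar ` x)"
    using fin assms(2) by (intro card_Un_disjoint) auto
  moreover have "card (bar ` x) = card x"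
    by (subst card_image) (auto simp: inj_on_def)
  ultimately show ?thesis using card_V[of n] by simp
qed

text \<open>A set without antipodal pairs is disjoint from its antipodal image inside the 2n
  vertices, so the size bound in \<open>faces\<close> is automatic.\<close>

lemma faces_iff: "x \<in> faces n \<longleftrightarrow> x \<subseteq> V n \<and> (\<forall>v\<in>x. bar v \<notin> x)"
proof
  assume x: "x \<in> faces n"
  then have sub: "x \<subseteq> V n" and le: "\<And>\<alpha>. \<alpha> \<in> Vdot n \<Longrightarrow> card (x \<inter> {\<alpha>, bar \<alpha>}) \<le> 1"
    by (auto simp: faces_def L_def)
  have "bar v \<notin> x" if v: "v \<in> x" for v
  proof
    assume b: "bar v \<in> x"
    obtain \<alpha> where \<alpha>: "\<alpha> \<in> Vdot n" "v = \<alpha> \<or> v = bar \<alpha>"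
      using v sub by (auto simp: V_def)
    then have "x \<inter> {\<alpha>, bar \<alpha>} = {\<alpha>, bar \<alpha>}" using v b by auto
    then show False using le[OF \<alpha>(1)] by simp
  qed
  then show "x \<subseteq> V n \<and> (\<forall>v\<in>x. bar v \<notin> x)" using sub by blast
next
  assume x: "x \<subseteq> V n \<and> (\<forall>v\<in>x. bar v \<notin> x)"
  have "card x \<le> n" using card_free[of x n] x by auto
  moreover have "card (x \<inter> {\<alpha>, bar \<alpha>}) \<le> 1" for \<alpha>
  proof -
    have "x \<inter> {\<alpha>, bar \<alpha>} = {} \<or> x \<inter> {\<alpha>, bar \<alpha>} = {\<alpha>} \<or> x \<inter> {\<alpha>, bar \<alpha>} = {bar \<alpha>}"
      using x by auto
    then show ?thesis by auto
  qed
  ultimately show "x \<in> faces n" using x by (auto simp: faces_def L_def)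
qed

lemma card_free_face: "x \<in> faces n \<Longrightarrow> card (free n x) + 2 * card x = 2 * n"
  by (rule card_free) (auto simp: faces_iff)

lemma card_face_le: "x \<in> faces n \<Longrightarrow> card x \<le> n"
  using card_free_face[of x n] by simp

lemma L_iff: "x \<in> L n k \<longleftrightarrow> x \<in> faces n \<and> card x = k"
proof
  assume "x \<in> faces n \<and> card x = k"
  then show "x \<in> L n k" by (auto simp: faces_def L_def)
next
  assume x: "x \<in> L n k"
  have "bar v \<notin> x" if v: "v \<in> x" for v
  proof
    assume b: "bar v \<in> x"
    obtain \<alpha> where \<alpha>: "\<alpha> \<in> Vdot n" "v = \<alpha> \<or> v = bar \<alpha>"
      using v x by (auto simp: V_def L_def)
    then have "x \<inter> {\<alpha>, bar \<alpha>} = {\<alpha>, bar \<alpha>}" using v b by auto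
    then show False using x \<alpha>(1) by (auto simp: L_def)
  qed
  then show "x \<in> faces n \<and> card x = k" using x by (auto simp: faces_iff L_def)
qed

lemma finite_faces [simp]: "finite (faces n)"
  by (rule finite_subset[of _ "Pow (V n)"]) (auto simp: faces_iff)

lemma finite_face: "x \<in> faces n \<Longrightarrow> finite x"
  using finite_subset[OF _ finite_V] by (auto simp: faces_iff)

lemma faces_subset: "x \<in> faces n \<Longrightarrow> y \<subseteq> x \<Longrightarrow> y \<in> faces n"
  by (auto simp: faces_iff)

lemma faces_insert: "x \<in> faces n \<Longrightarrow> v \<in> free n x \<Longrightarrow> insert v x \<in> faces n"
  by (auto simp: faces_iff free_def)

section \<open>Linear maps on chains\<close>

abbreviation linear_map :: "('a::field chain \<Rightarrow> 'a chain) \<Rightarrow> bool" where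
  "linear_map \<equiv> Vector_Spaces.linear scale scale"

lemma sum_chain_apply: "(\<Sum>i\<in>A. f i :: 'a::field chain) x = (\<Sum>i\<in>A. f i x)"
  by (induction A rule: infinite_finite_induct) auto

lemma linear_mapI:
  assumes "\<And>f g. \<phi> (f + g) = \<phi> f + \<phi> g" "\<And>c f. \<phi> (scale c f) = scale c (\<phi> f)"
  shows "linear_map \<phi>"
  unfolding Vector_Spaces.linear_def
  by (intro conjI module_hom.intro module_hom_axioms.intro assms
      chain.module_axioms chain.vector_space_axioms)

lemma
  assumes "linear_map \<phi>"
  shows linear_map_add: "\<phi> (f + g) = \<phi> f + \<phi> g"
    and linear_map_scale: "\<phi> (scale c f) = scale c (\<phi> f)"
    and linear_map_diff: "\<phi> (f - g) = \<phi> f - \<phi> g"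
    and linear_map_0: "\<phi> 0 = 0"
    and linear_map_sum: "\<phi> (\<Sum>i\<in>A. h i) = (\<Sum>i\<in>A. \<phi> (h i))"
proof -
  interpret Vector_Spaces.linear scale scale \<phi> by fact
  show "\<phi> (f + g) = \<phi> f + \<phi> g" "\<phi> (scale c f) = scale c (\<phi> f)" "\<phi> (f - g) = \<phi> f - \<phi> g" "\<phi> 0 = 0"
    "\<phi> (\<Sum>i\<in>A. h i) = (\<Sum>i\<in>A. \<phi> (h i))"
    by (auto simp: add scale diff zero sum)
qed

lemma linear_lin_ext: "linear_map (lin_ext n \<phi>)"
  by (rule linear_mapI)
    (auto simp: lin_ext_def chain.scale_left_distrib sum.distrib chain.scale_sum_right,
     auto simp: scale_def intro!: sum.cong)

lemma linear_eps: "linear_map (eps n)"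
  by (simp add: eps_def linear_lin_ext)

lemma linear_bd: "linear_map (bd n)"
  by (simp add: bd_def linear_lin_ext)

lemma linear_act: "linear_map (act n g)"
  by (simp add: act_def linear_lin_ext)

lemma lin_ext_apply: "lin_ext n \<phi> f y = (\<Sum>x\<in>faces n. f x * \<phi> x y)"
  by (simp add: lin_ext_def sum_chain_apply scale_def)

lemma sum_face_apply: "finite A \<Longrightarrow> (\<Sum>x\<in>A. face x :: 'a::field chain) y = (if y \<in> A then 1 else 0)"
  by (simp add: sum_chain_apply face_def)

text \<open>Transposing the sum over the basis: the coefficient at y collects f from the facets of
  y, so a sum over vertices replaces a sum over sets. The coefficient computations below rest on
  this form and on its counterpart for \<open>bd\<close>.\<close>

lemma eps_apply:
  "eps n f y = (if y \<in> faces n then \<Sum>v\<in>y. f (y - {v}) else (0::'a::field))"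
proof -
  have fin: "finite {y. y \<in> L n (card x + 1) \<and> x \<subset> y}" for x
    by (rule finite_subset[OF _ finite_faces[of n]]) (auto simp: L_iff)
  have "eps n f y = (\<Sum>x\<in>faces n. if y \<in> L n (card x + 1) \<and> x \<subset> y then f x else 0)"
    unfolding eps_def lin_ext_apply by (intro sum.cong refl) (subst sum_face_apply[OF fin], auto)
  also have "\<dots> = (\<Sum>x | x \<in> faces n \<and> y \<in> L n (card x + 1) \<and> x \<subset> y. f x)"
    by (simp add: sum.inter_filter)
  also have "\<dots> = (if y \<in> faces n then \<Sum>v\<in>y. f (y - {v}) else 0)"
  proof (cases "y \<in> faces n")
    case True
    have fy: "finite y" using True finite_face by blast
    have "{x. x \<in> faces n \<and> y \<in> L n (card x + 1) \<and> x \<subset> y} = (\<lambda>v. y - {v}) ` y"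
    proof (intro equalityI subsetI)
      fix x assume "x \<in> {x. x \<in> faces n \<and> y \<in> L n (card x + 1) \<and> x \<subset> y}"
      then have x: "x \<subset> y" "card y = card x + 1" by (auto simp: L_iff)
      then have "card (y - x) = 1" using fy by (subst card_Diff_subset) (auto intro: finite_subset)
      then obtain v where "y - x = {v}" by (auto simp: card_1_singleton_iff)
      then show "x \<in> (\<lambda>v. y - {v}) ` y" using x by blast
    next
      fix x assume "x \<in> (\<lambda>v. y - {v}) ` y"
      then obtain v where v: "v \<in> y" "x = y - {v}" by blast
      then show "x \<in> {x. x \<in> faces n \<and> y \<in> L n (card x + 1) \<and> x \<subset> y}"
        using True card_Suc_Diff1[OF fy v(1)] faces_subset[OF True, of x] by (auto simp: L_iff)
    qed
    moreover have "inj_on (\<lambda>v. y - {v}) y" by (auto simp: inj_on_def)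
    ultimately show ?thesis using True by (simp add: sum.reindex)
  qed (simp add: L_iff)
  finally show ?thesis .
qed

lemma bd_apply:
  "bd n f z = (if z \<in> faces n then \<Sum>v\<in>free n z. f (insert v z) else (0::'a::field))"
proof -
  have fin: "finite {z. z \<in> faces n \<and> card z + 1 = card x \<and> z \<subset> x}" for x
    by (rule finite_subset[OF _ finite_faces[of n]]) auto
  have "bd n f z = (\<Sum>x\<in>faces n. if z \<in> faces n \<and> card z + 1 = card x \<and> z \<subset> x then f x else 0)"
    unfolding bd_def lin_ext_apply by (intro sum.cong refl) (simp add: sum_face_apply fin)
  also have "\<dots> = (\<Sum>x | x \<in> faces n \<and> z \<in> faces n \<and> card z + 1 = card x \<and> z \<subset> x. f x)"
    by (simp add: sum.inter_filter)
  also have "\<dots> = (if z \<in> faces n then \<Sum>v\<in>free n z. f (insert v z) else 0)"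
  proof (cases "z \<in> faces n")
    case True
    have fz: "finite z" using True finite_face by blast
    have "{x. x \<in> faces n \<and> z \<in> faces n \<and> card z + 1 = card x \<and> z \<subset> x} = (\<lambda>v. insert v z) ` free n z"
    proof (intro equalityI subsetI)
      fix x assume "x \<in> {x. x \<in> faces n \<and> z \<in> faces n \<and> card z + 1 = card x \<and> z \<subset> x}"
      then have x: "z \<subset> x" "card z + 1 = card x" "x \<in> faces n" by auto
      then have "card (x - z) = 1" using fz by (subst card_Diff_subset) auto
      then obtain v where v: "x - z = {v}" by (auto simp: card_1_singleton_iff)
      then have "x = insert v z" using x by blast
      moreover have "v \<in> free n z" using v x(1,3) by (auto simp: free_def faces_iff)
      ultimately show "x \<in> (\<lambda>v. insert v z) ` free n z" by blast
    next
      fix x assume "x \<in> (\<lambda>v. insert v z) ` free n z"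
      then show "x \<in> {x. x \<in> faces n \<and> z \<in> faces n \<and> card z + 1 = card x \<and> z \<subset> x}"
        using True fz faces_insert[OF True] by (auto simp: free_def)
    qed
    moreover have "inj_on (\<lambda>v. insert v z) (free n z)"
      by (auto simp: inj_on_def free_def)
    ultimately show ?thesis using True by (simp add: sum.reindex)
  qed auto
  finally show ?thesis .
qed

lemma M_iff: "f \<in> M n k \<longleftrightarrow> (\<forall>x. x \<in> faces n \<and> card x = k \<or> f x = 0)"
  by (auto simp: M_def L_iff)

lemma subspace_M: "chain.subspace (M n k)"
proof (rule chain.subspaceI)
  fix f g :: "'a chain" and c
  assume "f \<in> M n k"
  then have f: "f x = 0" if "x \<notin> L n k" for x using that by (auto simp: M_def)
  then show "scale c f \<in> M n k" by (auto simp: M_def scale_def)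
  assume "g \<in> M n k"
  then have "g x = 0" if "x \<notin> L n k" for x using that by (auto simp: M_def)
  then have "(f + g) x = 0" if "x \<notin> L n k" for x using f that by simp
  then show "f + g \<in> M n k" unfolding M_def by blast
qed (simp add: M_def)

lemma eps_M: "f \<in> M n k \<Longrightarrow> eps n f \<in> M n (Suc k)"
  unfolding M_iff eps_apply
proof (intro allI)
  fix y
  assume f: "\<forall>x. x \<in> faces n \<and> card x = k \<or> f x = 0"
  have "f (y - {v}) = 0" if "y \<in> faces n" "card y \<noteq> Suc k" "v \<in> y" for v
    using f finite_face[OF that(1)] that by (metis card_Suc_Diff1)
  then show "y \<in> faces n \<and> card y = Suc k \<or> (if y \<in> faces n then \<Sum>v\<in>y. f (y - {v}) else 0) = 0"
    by (auto intro!: sum.neutral)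
qed

lemma bd_M: "f \<in> M n (Suc k) \<Longrightarrow> bd n f \<in> M n k"
  unfolding M_iff bd_apply
proof (intro allI)
  fix y
  assume f: "\<forall>x. x \<in> faces n \<and> card x = Suc k \<or> f x = 0"
  have "f (insert v y) = 0" if "y \<in> faces n" "card y \<noteq> k" "v \<in> free n y" for v
    using f finite_face[OF that(1)] that by (metis (no_types, lifting) card_insert_disjoint free_def mem_Collect_eq nat.inject)
  then show "y \<in> faces n \<and> card y = k \<or> (if y \<in> faces n then \<Sum>v\<in>free n y. f (insert v y) else 0) = 0"
    by (auto intro!: sum.neutral)
qed

lemma M_0_bd: "f \<in> M n 0 \<Longrightarrow> bd n f = 0"
proof
  fix y assume f: "f \<in> M n 0"
  have "f (insert v y) = 0" if "y \<in> faces n" for v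
  proof -
    have "card (insert v y) \<noteq> 0" using finite_face[OF that] by simp
    then show ?thesis using f unfolding M_iff by metis
  qed
  then show "bd n f y = 0 y" by (auto simp: bd_apply)
qed

lemma M_eq_0: "f \<in> M n k \<Longrightarrow> n < k \<Longrightarrow> f = 0"
  by (fastforce simp: M_iff fun_eq_iff dest: card_face_le)

section \<open>The action of the hyperoctahedral group\<close>

lemma hyperoctD:
  assumes "g \<in> carrier (hyperoct n)"
  shows "bij g" "v \<in> V n \<Longrightarrow> g (bar v) = bar (g v)" "g v \<in> V n \<longleftrightarrow> v \<in> V n"
proof -
  have p: "g permutes V n" using assms by (simp add: hyperoct_def)
  show "bij g" using p by (rule permutes_bij)
  show c: "v \<in> V n \<Longrightarrow> g (bar v) = bar (g v)" for v using assms by (simp add: hyperoct_def)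
  show m: "g v \<in> V n \<longleftrightarrow> v \<in> V n" for v using p by (rule permutes_in_image)
qed

lemma hyperoct_image_faces:
  assumes "g \<in> carrier (hyperoct n)"
  shows "g ` x \<in> faces n \<longleftrightarrow> x \<in> faces n"
proof -
  have i: "inj g" using hyperoctD(1)[OF assms] by (simp add: bij_def)
  have sub: "g ` x \<subseteq> V n \<longleftrightarrow> x \<subseteq> V n" using hyperoctD(3)[OF assms] by auto
  have "bar (g v) \<in> g ` x \<longleftrightarrow> bar v \<in> x" if "v \<in> V n" for v
    using hyperoctD(2)[OF assms that] i by (metis inj_image_mem_iff)
  then have "(\<forall>v\<in>x. bar (g v) \<notin> g ` x) \<longleftrightarrow> (\<forall>v\<in>x. bar v \<notin> x)" if "x \<subseteq> V n"
    using that by blast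
  then show ?thesis unfolding faces_iff using sub by blast
qed

lemma act_apply:
  assumes "g \<in> carrier (hyperoct n)"
  shows "act n g f (g ` x) = (if x \<in> faces n then f x else (0::'a::field))"
proof -
  have "g ` x = g ` y \<longleftrightarrow> x = y" for y
    using hyperoctD(1)[OF assms] by (simp add: bij_def inj_image_eq_iff)
  then have "act n g f (g ` x) = (\<Sum>y\<in>faces n. if x = y then f y else 0)"
    unfolding act_def lin_ext_apply face_def by (intro sum.cong refl) auto
  then show ?thesis by simp
qed

text \<open>Every set is an image under the bijection g. Since \<open>act_apply\<close> gives
  coefficients at images, equalities of chains can be checked without inverting g.\<close>

lemma chain_eqI_image:
  assumes "g \<in> carrier (hyperoct n)" "\<And>x. f (g ` x) = h (g ` x)"
  shows "f = h"
proof
  fix y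
  have "y = g ` (g -` y)" using hyperoctD(1)[OF assms(1)] by (simp add: bij_def surj_image_vimage_eq)
  then show "f y = h y" using assms(2)[of "g -` y"] by simp
qed

lemma free_image:
  assumes "g \<in> carrier (hyperoct n)"
  shows "free n (g ` x) = g ` free n x"
proof -
  have b: "bij g" using hyperoctD(1)[OF assms] .
  have i: "\<And>v. g v \<in> g ` x \<longleftrightarrow> v \<in> x" using b by (simp add: bij_def inj_image_mem_iff)
  have iff: "g v \<in> free n (g ` x) \<longleftrightarrow> v \<in> free n x" for v
  proof (cases "v \<in> V n")
    case True
    then have "bar (g v) \<in> g ` x \<longleftrightarrow> bar v \<in> x"
      using i[of "bar v"] hyperoctD(2)[OF assms True] by simp
    then show ?thesis using True i[of v] hyperoctD(3)[OF assms, of v] by (simp add: free_def)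
  qed (use hyperoctD(3)[OF assms, of v] in \<open>simp add: free_def\<close>)
  have "free n (g ` x) = g ` (g -` free n (g ` x))"
    using b by (simp add: bij_def surj_image_vimage_eq)
  also have "g -` free n (g ` x) = free n x" using iff by (simp add: vimage_def)
  finally show ?thesis .
qed

lemma act_eps:
  assumes "g \<in> carrier (hyperoct n)"
  shows "act n g (eps n f) = eps n (act n g f :: 'a::field chain)"
proof (rule chain_eqI_image[OF assms])
  fix x
  have i: "inj g" using hyperoctD(1)[OF assms] by (simp add: bij_def)
  have "g ` x - {g v} = g ` (x - {v})" for v
    using i by (auto simp: inj_def)
  then show "act n g (eps n f) (g ` x) = eps n (act n g f) (g ` x)"
    using faces_subset[of x n]
    by (auto simp: act_apply[OF assms] eps_apply hyperoct_image_faces[OF assms]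
        sum.reindex inj_on_subset[OF i] intro!: sum.cong)
qed

lemma act_bd:
  assumes "g \<in> carrier (hyperoct n)"
  shows "act n g (bd n f) = bd n (act n g f :: 'a::field chain)"
proof (rule chain_eqI_image[OF assms])
  fix x
  have i: "inj g" using hyperoctD(1)[OF assms] by (simp add: bij_def)
  have "insert (g v) (g ` x) = g ` (insert v x)" for v by auto
  then show "act n g (bd n f) (g ` x) = bd n (act n g f) (g ` x)"
    using faces_insert[of x n]
    by (auto simp: act_apply[OF assms] bd_apply hyperoct_image_faces[OF assms] free_image[OF assms]
        sum.reindex inj_on_subset[OF i] simp del: image_insert intro!: sum.cong)
qed

lemma act_M:
  assumes "g \<in> carrier (hyperoct n)" "f \<in> M n k"
  shows "act n g f \<in> M n k"
  unfolding M_iff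
proof
  fix y
  have b: "bij g" using hyperoctD(1)[OF assms(1)] .
  define x where "x = g -` y"
  have y: "y = g ` x" unfolding x_def using b by (simp add: bij_def surj_image_vimage_eq)
  have "card y = card x" unfolding y using b by (intro card_image inj_on_subset[OF bij_is_inj]) auto
  then show "y \<in> faces n \<and> card y = k \<or> act n g f y = 0"
    using assms(2) by (auto simp: y act_apply[OF assms(1)] hyperoct_image_faces[OF assms(1)] M_iff)
qed

section \<open>Antipodal flips and their sum\<close>

abbreviation flip :: "vertex \<Rightarrow> vertex \<Rightarrow> vertex" where
  "flip \<alpha> \<equiv> transpose \<alpha> (bar \<alpha>)"

lemma flip_hyperoct: "\<alpha> \<in> V n \<Longrightarrow> flip \<alpha> \<in> carrier (hyperoct n)"
  by (auto simp: hyperoct_def permutes_swap_id transpose_def)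

lemma flip_bar [simp]: "transpose (bar \<alpha>) \<alpha> = flip \<alpha>"
  by (simp add: transpose_commute)

lemma flip_image: "w \<in> x \<Longrightarrow> bar w \<notin> x \<Longrightarrow> flip w ` x = insert (bar w) (x - {w})"
  by (auto simp: transpose_def image_iff split: if_splits)

lemma flip_image_id: "w \<notin> x \<Longrightarrow> bar w \<notin> x \<Longrightarrow> flip w ` x = x"
  by (force simp: transpose_def image_iff split: if_splits)

lemma act_flip:
  assumes "\<alpha> \<in> V n"
  shows "act n (flip \<alpha>) f y = (if y \<in> faces n then f (flip \<alpha> ` y) else (0::'a::field))"
proof -
  have "flip \<alpha> ` flip \<alpha> ` y = y" by (simp add: image_comp)
  then show ?thesis
    using act_apply[OF flip_hyperoct[OF assms], of f "flip \<alpha> ` y"]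
      hyperoct_image_faces[OF flip_hyperoct[OF assms], of y] by simp
qed

text \<open>The operator T of the overview. Summing over \<open>Vdot n\<close> takes each antipodal
  pair once.\<close>

definition flip_sum :: "nat \<Rightarrow> 'a chain \<Rightarrow> 'a::field chain" where
  "flip_sum n f = (\<Sum>\<alpha>\<in>Vdot n. act n (flip \<alpha>) f)"

lemma linear_flip_sum: "linear_map (flip_sum n)"
  by (rule linear_mapI)
    (simp_all add: flip_sum_def linear_map_add[OF linear_act] linear_map_scale[OF linear_act]
      sum.distrib chain.scale_sum_right)

lemma Vdot_subset_V: "Vdot n \<subseteq> V n"
  by (auto simp: V_def)

lemma flip_sum_eps: "flip_sum n (eps n f) = eps n (flip_sum n f)"
  unfolding flip_sum_def linear_map_sum[OF linear_eps]
  using Vdot_subset_V by (intro sum.cong refl act_eps flip_hyperoct) blast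

lemma flip_sum_bd: "flip_sum n (bd n f) = bd n (flip_sum n f)"
  unfolding flip_sum_def linear_map_sum[OF linear_bd]
  using Vdot_subset_V by (intro sum.cong refl act_bd flip_hyperoct) blast

text \<open>The flip of a pair that misses x fixes x, and there are n - card x such pairs; the flip
  of a pair met in w replaces w by \<open>bar w\<close>.\<close>

lemma flip_sum_apply:
  assumes x: "x \<in> faces n"
  shows "flip_sum n f x = of_nat (n - card x) * f x + (\<Sum>w\<in>x. f (insert (bar w) (x - {w})))"
proof -
  define A where "A = {\<alpha> \<in> Vdot n. \<alpha> \<in> x \<or> bar \<alpha> \<in> x}"
  \<comment> \<open>The representative in \<open>Vdot n\<close> of the antipodal pair of w. It lets
    the vertices of x index the pairs met by x, since \<open>flip\<close> depends on the pair
    only.\<close>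
  define h where "h w = (if w \<in> Vdot n then w else bar w)" for w
  have xV: "x \<subseteq> V n" and xb: "\<And>w. w \<in> x \<Longrightarrow> bar w \<notin> x" using x by (auto simp: faces_iff)
  have inj: "inj_on h x" using xb by (auto simp: inj_on_def h_def split: if_splits)
  have im: "h ` x = A"
  proof (intro equalityI subsetI)
    fix \<alpha> assume "\<alpha> \<in> A"
    then have "h \<alpha> = \<alpha>" "h (bar \<alpha>) = \<alpha>" "\<alpha> \<in> x \<or> bar \<alpha> \<in> x"
      by (auto simp: A_def h_def bar_Vdot)
    then show "\<alpha> \<in> h ` x" by (metis imageI)
  next
    fix \<alpha> assume "\<alpha> \<in> h ` x"
    then show "\<alpha> \<in> A" using xV by (auto simp: A_def h_def V_def)
  qed
  have flip_h: "flip (h w) = flip w" for w by (simp add: h_def)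
  have "flip_sum n f x = (\<Sum>\<alpha>\<in>Vdot n. f (flip \<alpha> ` x))"
    unfolding flip_sum_def sum_chain_apply
    using x by (intro sum.cong refl) (auto simp: act_flip subsetD[OF Vdot_subset_V])
  also have "\<dots> = (\<Sum>\<alpha>\<in>Vdot n - A. f (flip \<alpha> ` x)) + (\<Sum>\<alpha>\<in>A. f (flip \<alpha> ` x))"
    by (rule sum.subset_diff) (auto simp: A_def)
  also have "(\<Sum>\<alpha>\<in>Vdot n - A. f (flip \<alpha> ` x)) = (\<Sum>\<alpha>\<in>Vdot n - A. f x)"
    by (intro sum.cong refl) (simp add: A_def flip_image_id)
  also have "\<dots> = of_nat (card (Vdot n - A)) * f x" by simp
  also have "card (Vdot n - A) = n - card A"
    by (subst card_Diff_subset) (auto simp: A_def)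
  also have "card A = card x" using card_image[OF inj] im by simp
  also have "(\<Sum>\<alpha>\<in>A. f (flip \<alpha> ` x)) = (\<Sum>w\<in>x. f (flip w ` x))"
    unfolding im[symmetric] by (simp add: sum.reindex[OF inj] flip_h)
  also have "\<dots> = (\<Sum>w\<in>x. f (insert (bar w) (x - {w})))"
    using xb by (intro sum.cong refl) (simp add: flip_image)
  finally show ?thesis .
qed

text \<open>Adding a vertex v free for x and removing w in x gives the same set in both orders, so
  these terms cancel. What is left is 2n - 2k returns to x when adding comes second, against k
  returns to x and the replacements of w by \<open>bar w\<close> when removing comes second. T
  accounts for the replacements but also contributes n - k, whence 2(n - k) - k + (n - k) = 3n -
  4k.\<close>

lemma commutator:
  assumes f: "f \<in> M n k"
  shows "bd n (eps n f) - eps n (bd n f) = scale (of_int (3 * int n - 4 * int k)) f - flip_sum n (f :: 'a::field chain)"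
proof
  fix x
  show "(bd n (eps n f) - eps n (bd n f)) x = (scale (of_int (3 * int n - 4 * int k)) f - flip_sum n f) x"
  proof (cases "x \<in> faces n")
    case False
    moreover have "flip_sum n f x = 0"
      unfolding flip_sum_def sum_chain_apply
      using False by (intro sum.neutral) (auto simp: act_flip subsetD[OF Vdot_subset_V])
    moreover have "f x = 0" using f False by (auto simp: M_iff)
    ultimately show ?thesis by (simp add: bd_apply eps_apply scale_def)
  next
    case True
    have fin: "finite x" using True finite_face by blast
    have xV: "x \<subseteq> V n" and xb: "\<And>w. w \<in> x \<Longrightarrow> bar w \<notin> x" using True by (auto simp: faces_iff)
    define S where "S = (\<Sum>w\<in>x. \<Sum>v\<in>free n x. f (insert v (x - {w})))"
    have "bd n (eps n f) x = (\<Sum>v\<in>free n x. f x + (\<Sum>w\<in>x. f (insert v (x - {w}))))"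
    proof -
      have "eps n f (insert v x) = f x + (\<Sum>w\<in>x. f (insert v (x - {w})))" if v: "v \<in> free n x" for v
      proof -
        have "v \<notin> x" using v by (simp add: free_def)
        then have "insert v x - {v} = x" "\<And>w. w \<in> x \<Longrightarrow> insert v x - {w} = insert v (x - {w})" by auto
        then show ?thesis
          using faces_insert[OF True v] \<open>v \<notin> x\<close> fin by (simp add: eps_apply)
      qed
      then show ?thesis using True by (simp add: bd_apply)
    qed
    then have 1: "bd n (eps n f) x = of_nat (card (free n x)) * f x + S"
      by (simp add: sum.distrib S_def sum.swap[of _ x])
    have "eps n (bd n f) x = (\<Sum>w\<in>x. f x + f (insert (bar w) (x - {w})) + (\<Sum>v\<in>free n x. f (insert v (x - {w}))))"
    proof -
      have "bd n f (x - {w}) = f x + f (insert (bar w) (x - {w})) + (\<Sum>v\<in>free n x. f (insert v (x - {w})))"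
        if w: "w \<in> x" for w
      proof -
        \<comment> \<open>Besides the free vertices of x, removing w frees w itself, which leads
          back to x, and \<open>bar w\<close>, which leads to the flipped face.\<close>
        have fr: "free n (x - {w}) = insert w (insert (bar w) (free n x))"
        proof (intro equalityI subsetI)
          fix v assume "v \<in> free n (x - {w})"
          then show "v \<in> insert w (insert (bar w) (free n x))"
            by (auto simp: free_def)
        next
          fix v assume "v \<in> insert w (insert (bar w) (free n x))"
          then show "v \<in> free n (x - {w})" using w xV xb by (auto simp: free_def)
        qed
        have "w \<notin> free n x" "bar w \<notin> free n x" using w by (auto simp: free_def)
        then show ?thesis
          using faces_subset[OF True, of "x - {w}"] w by (auto simp: bd_apply fr insert_absorb)
      qed
      then show ?thesis using True by (simp add: eps_apply)
    qed
    then have 2: "eps n (bd n f) x = of_nat (card x) * f x + (\<Sum>w\<in>x. f (insert (bar w) (x - {w}))) + S"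
      by (simp add: sum.distrib S_def)
    show ?thesis
    proof (cases "card x = k")
      case k: True
      have kn: "k \<le> n" using card_face_le[OF True] k by simp
      have "int (card (free n x)) = 2 * int n - 2 * int k"
        using card_free_face[OF True] k by simp
      then have c: "of_nat (card (free n x)) = (of_int (2 * int n - 2 * int k) :: 'a)"
        by (metis of_int_of_nat_eq)
      have d: "of_nat (n - k) = (of_nat n - of_nat k :: 'a)"
        using kn by (simp add: of_nat_diff)
      show ?thesis
        using k by (simp add: 1 2 flip_sum_apply[OF True] c d scale_def algebra_simps)
    next
      case False
      \<comment> \<open>Outside the common term \<open>S\<close> only sets with card x elements
        occur, and f vanishes on them.\<close>
      have "f y = 0" if "card y = card x" for y
        using f False that unfolding M_iff by metis
      moreover have "card (insert (bar w) (x - {w})) = card x" if "w \<in> x" for w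
        using that xb[OF that] fin card_Suc_Diff1[OF fin that] by simp
      ultimately have "f x = 0" "(\<Sum>w\<in>x. f (insert (bar w) (x - {w}))) = 0"
        by (auto intro!: sum.neutral)
      then show ?thesis
        by (simp add: 1 2 flip_sum_apply[OF True] scale_def)
    qed
  qed
qed

section \<open>Eigenvectors\<close>

text \<open>Applying \<open>T - l s\<close> to the vanishing sum removes the term s and multiplies
  every other term by the nonzero number \<open>l t - l s\<close>; induction then applies to the
  shorter sum.\<close>

lemma eigen_indep:
  assumes T: "linear_map (T :: 'a::field chain \<Rightarrow> 'a chain)" and "finite I" "inj_on l I"
    "\<And>t. t \<in> I \<Longrightarrow> T (v t) = scale (l t) (v t)" "(\<Sum>t\<in>I. v t) = 0" "t \<in> I"
  shows "v t = 0"
  using assms(2-)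
proof (induction I arbitrary: v t rule: finite_induct)
  case (insert s I)
  define w where "w t = scale (l t - l s) (v t)" for t
  have "T (\<Sum>t\<in>insert s I. v t) - scale (l s) (\<Sum>t\<in>insert s I. v t) = (\<Sum>t\<in>insert s I. w t)"
    unfolding linear_map_sum[OF T] chain.scale_sum_right sum_subtractf[symmetric] w_def
    using insert.prems(2) by (intro sum.cong refl) (simp add: chain.scale_left_diff_distrib)
  moreover have ws: "w s = 0" by (simp add: w_def)
  ultimately have "0 = (\<Sum>t\<in>I. w t)"
    unfolding insert.prems(3) unfolding sum.insert[OF insert.hyps]
    by (simp only: linear_map_0[OF T] chain.scale_zero_right diff_self ws add_0_left)
  have "T (w t) = scale (l t) (w t)" if "t \<in> I" for t
    using insert.prems(2)[of t] that by (simp add: w_def linear_map_scale[OF T] mult.commute)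
  then have "w t = 0" if "t \<in> I" for t
    using insert.IH[of w t, OF _ _ \<open>0 = (\<Sum>t\<in>I. w t)\<close>[symmetric]] insert.prems(1) that by (auto simp: inj_on_def)
  then have z: "v t = 0" if "t \<in> I" for t
    using insert.prems(1) insert.hyps that by (auto simp: w_def inj_on_def chain.scale_eq_0_iff)
  moreover have "v s = 0"
  proof -
    have "(\<Sum>t\<in>I. v t) = 0" using z by (intro sum.neutral) blast
    then show ?thesis
      using insert.prems(3) unfolding sum.insert[OF insert.hyps] by (simp only: add_0_right)
  qed
  ultimately show ?case using insert.prems(4) by auto
qed auto

text \<open>Subtracting f from its component at s gives a family of eigenvectors with sum 0, to
  which independence applies. In this way a decomposition identifies an eigenspace.\<close>

lemma eigen_component:
  assumes T: "linear_map (T :: 'a::field chain \<Rightarrow> 'a chain)" and I: "finite I" "inj_on l I"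
    and v: "\<And>t. t \<in> I \<Longrightarrow> T (v t) = scale (l t) (v t)"
    and f: "f = (\<Sum>t\<in>I. v t)" "T f = scale (l s) f" and s: "s \<in> I"
  shows "f = v s"
proof -
  define w where "w t = v t - (if t = s then f else 0)" for t
  have "w s = 0"
  proof (rule eigen_indep[OF T I _ _ s, of w])
    have "(\<Sum>t\<in>I. if t = s then f else 0) = f" using I(1) s by simp
    then show "(\<Sum>t\<in>I. w t) = 0" by (simp only: w_def sum_subtractf f(1)[symmetric] diff_self)
    fix t assume "t \<in> I"
    moreover have "T (if t = s then f else 0) = scale (l t) (if t = s then f else 0)"
      by (cases "t = s") (simp_all only: f(2) simp_thms if_True if_False linear_map_0[OF T] chain.scale_zero_right)
    ultimately show "T (w t) = scale (l t) (w t)"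
      by (simp only: w_def linear_map_diff[OF T] v chain.scale_right_diff_distrib)
  qed
  then show ?thesis by (simp add: w_def)
qed

lemma subspace_eigen:
  assumes "linear_map T" "chain.subspace U"
  shows "chain.subspace {f \<in> U. T f = scale c (f :: 'a::field chain)}"
  using assms(2) unfolding chain.subspace_def
  by (auto simp: linear_map_0 linear_map_add linear_map_scale chain.scale_right_distrib mult.commute assms(1))

lemma subspace_sums:
  assumes "\<And>t. t \<in> I \<Longrightarrow> chain.subspace (N t)"
  shows "chain.subspace {\<Sum>t\<in>I. v t | v. \<forall>t\<in>I. v t \<in> (N t :: 'a::field chain set)}"
proof (rule chain.subspaceI)
  show "0 \<in> {\<Sum>t\<in>I. v t | v. \<forall>t\<in>I. v t \<in> N t}"
    using assms by (auto intro!: exI[of _ "\<lambda>_. 0"] simp: chain.subspace_0)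
next
  fix f g assume "f \<in> {\<Sum>t\<in>I. v t | v. \<forall>t\<in>I. v t \<in> N t}" "g \<in> {\<Sum>t\<in>I. v t | v. \<forall>t\<in>I. v t \<in> N t}"
  then obtain u v where "f = sum u I" "\<forall>t\<in>I. u t \<in> N t" "g = sum v I" "\<forall>t\<in>I. v t \<in> N t" by blast
  then show "f + g \<in> {\<Sum>t\<in>I. v t | v. \<forall>t\<in>I. v t \<in> N t}"
    using assms by (auto intro!: exI[of _ "\<lambda>t. u t + v t"] simp: sum.distrib chain.subspace_add)
next
  fix f c assume "f \<in> {\<Sum>t\<in>I. v t | v. \<forall>t\<in>I. v t \<in> N t}"
  then obtain u where "f = sum u I" "\<forall>t\<in>I. u t \<in> N t" by blast
  then show "scale c f \<in> {\<Sum>t\<in>I. v t | v. \<forall>t\<in>I. v t \<in> N t}"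
    using assms by (auto intro!: exI[of _ "\<lambda>t. scale c (u t)"] simp: chain.scale_sum_right chain.subspace_scale)
qed

lemma span_UN_sums:
  assumes "finite I" "f \<in> chain.span (\<Union>t\<in>I. A t)"
  shows "\<exists>v. (\<forall>t\<in>I. v t \<in> chain.span (A t)) \<and> (f :: 'a::field chain) = (\<Sum>t\<in>I. v t)"
proof -
  let ?S = "{\<Sum>t\<in>I. v t | v. \<forall>t\<in>I. v t \<in> chain.span (A t)}"
  have "(\<Union>t\<in>I. A t) \<subseteq> ?S"
  proof
    fix a assume "a \<in> (\<Union>t\<in>I. A t)"
    then obtain t where t: "t \<in> I" "a \<in> A t" by blast
    then have "a = (\<Sum>s\<in>I. if s = t then a else 0)" using assms(1) by simp
    moreover have "\<forall>s\<in>I. (if s = t then a else 0) \<in> chain.span (A s)"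
      using t by (auto simp: chain.span_base chain.span_zero)
    ultimately show "a \<in> ?S" by blast
  qed
  then have "chain.span (\<Union>t\<in>I. A t) \<subseteq> ?S"
    by (intro chain.span_minimal subspace_sums) auto
  then show ?thesis using assms(2) by blast
qed

section \<open>Coefficients of products of vertex polynomials\<close>

lemma linear_chain_mult: "linear_map (chain_mult f)"
  by (rule linear_mapI)
    (simp_all add: fun_eq_iff chain_mult_def scale_def algebra_simps sum.distrib sum_distrib_left)

lemma chain_mult_lincomb_left:
  "chain_mult (scale r f + scale s g) h = scale r (chain_mult f h) + scale s (chain_mult g h)"
  by (simp add: fun_eq_iff chain_mult_def scale_def algebra_simps sum.distrib sum_distrib_left)

lemma chain_mult_infinite: "infinite z \<Longrightarrow> chain_mult f g z = 0"
  by (simp add: chain_mult_def)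

lemma chain_mult_commute: "chain_mult f g = chain_mult g (f :: 'a::field chain)"
proof
  fix z
  show "chain_mult f g z = chain_mult g f z"
    unfolding chain_mult_def
    by (rule sum.reindex_bij_witness[where i = "\<lambda>x. z - x" and j = "\<lambda>x. z - x"])
      (auto simp: double_diff mult.commute)
qed

lemma chain_mult_assoc: "chain_mult (chain_mult f g) h = chain_mult f (chain_mult g (h :: 'a::field chain))"
  by (metis chain_mult_commute chain_mult_left_commute)

text \<open>\<open>face {}\<close> is neutral for \<open>chain_mult\<close> only on chains that
  vanish at infinite sets, because every product is 0 there; products over finite sets are such
  chains.\<close>

lemma chain_prod_infinite: "finite A \<Longrightarrow> infinite z \<Longrightarrow> chain_prod F A z = 0"
  by (induction A rule: finite_induct) (auto simp: face_def chain_mult_infinite)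

lemma chain_prod_cong:
  assumes "finite A" "\<And>v. v \<in> A \<Longrightarrow> F v = G v"
  shows "chain_prod F A = chain_prod G A"
  using assms by (induction A rule: finite_induct) auto

lemma chain_mult_face_singleton:
  "chain_mult (face {v}) f z = (if finite z \<and> v \<in> z then f (z - {v}) else (0::'a::field))"
proof (cases "finite z")
  case True
  have "chain_mult (face {v}) f z = (\<Sum>x\<in>Pow z. if x = {v} then f (z - {v}) else 0)"
    unfolding chain_mult_def by (intro sum.cong refl) (simp add: face_def)
  then show ?thesis using True by simp
qed (simp add: chain_mult_infinite)

lemma chain_mult_face_empty: "chain_mult (face {}) f z = (if finite z then f z else (0::'a::field))"
proof (cases "finite z")
  case True
  have "chain_mult (face {}) f z = (\<Sum>x\<in>Pow z. if x = {} then f z else 0)"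
    unfolding chain_mult_def by (intro sum.cong refl) (simp add: face_def)
  then show ?thesis using True by simp
qed (simp add: chain_mult_infinite)

text \<open>The two products in a bracket merge into one product over the union, whose factor at v
  is selected by membership in b; a single induction then gives all coefficients.\<close>

lemma chain_mult_chain_prod:
  assumes "finite a" "finite b" "a \<inter> b = {}"
  shows "chain_mult (chain_prod F a) (chain_prod G b)
    = chain_prod (\<lambda>v. if v \<in> b then G v else F v) (a \<union> b)"
  using assms
proof (induction a rule: finite_induct)
  case empty
  have "chain_mult (face {}) (chain_prod G b) = chain_prod G b"
    using empty by (auto simp: fun_eq_iff chain_mult_face_empty chain_prod_infinite)
  then show ?case using empty by (auto intro: chain_prod_cong)
qed (auto simp: chain_mult_assoc)

text \<open>For c inside \<open>Vdot n\<close> these are the monomials of a product, over \<alpha>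
  in c, of linear forms in \<alpha> and \<open>bar \<alpha>\<close>.\<close>

definition transversal :: "vertex set \<Rightarrow> vertex set set" where
  "transversal c = {z. z \<subseteq> c \<union> bar ` c \<and> (\<forall>\<alpha>\<in>c. \<alpha> \<in> z \<longleftrightarrow> bar \<alpha> \<notin> z)}"

lemma bar_swap: "bar u = v \<longleftrightarrow> u = bar v"
  by auto

lemma bar_image_iff [simp]: "v \<in> bar ` c \<longleftrightarrow> bar v \<in> c"
  by (metis bar_bar imageE imageI)

text \<open>In both statements the antipode of the removed vertex is absent from z: on the left
  because a transversal picks one vertex per pair, on the right because c does not reach the pair of
  v.\<close>

lemma
  assumes "v \<notin> c" "bar v \<notin> c"
  shows transversal_insert1: "v \<in> z \<Longrightarrow> z \<in> transversal (insert v c) \<longleftrightarrow> z - {v} \<in> transversal c"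
    and transversal_insert2: "bar v \<in> z \<Longrightarrow> z \<in> transversal (insert v c) \<longleftrightarrow> z - {bar v} \<in> transversal c"
proof -
  have n: "\<alpha> \<noteq> v" "\<alpha> \<noteq> bar v" "bar \<alpha> \<noteq> v" "bar \<alpha> \<noteq> bar v" if "\<alpha> \<in> c" for \<alpha>
    using assms that by (auto simp: bar_swap)
  have s: "z \<subseteq> insert v c \<union> bar ` insert v c \<longleftrightarrow> z - {v, bar v} \<subseteq> c \<union> bar ` c"
    by (auto simp: bar_swap)
  show "z \<in> transversal (insert v c) \<longleftrightarrow> z - {v} \<in> transversal c" if "v \<in> z"
  proof -
    have "z - {v} \<subseteq> c \<union> bar ` c \<longleftrightarrow> z - {v, bar v} \<subseteq> c \<union> bar ` c \<and> bar v \<notin> z"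
      using assms by auto
    then show ?thesis unfolding transversal_def mem_Collect_eq s using that n by auto
  qed
  show "z \<in> transversal (insert v c) \<longleftrightarrow> z - {bar v} \<in> transversal c" if "bar v \<in> z"
  proof -
    have "z - {bar v} \<subseteq> c \<union> bar ` c \<longleftrightarrow> z - {v, bar v} \<subseteq> c \<union> bar ` c \<and> v \<notin> z"
      using assms by auto
    then show ?thesis unfolding transversal_def mem_Collect_eq s using that n by auto
  qed
qed

text \<open>When the product is expanded, z selects one term of each factor. The coefficients are
  kept general because two cases are needed: 1 and -1 for brackets, 0 and 1 for a single
  face.\<close>

lemma chain_prod_apply:
  assumes "finite c" "c \<subseteq> Vdot n"
  shows "chain_prod (\<lambda>\<alpha>. scale (r \<alpha>) (face {\<alpha>}) + scale (s \<alpha>) (face {bar \<alpha>})) c z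
    = (if z \<in> transversal c then \<Prod>\<alpha>\<in>c. if \<alpha> \<in> z then r \<alpha> else s \<alpha> else (0::'a::field))"
  using assms
proof (induction c arbitrary: z rule: finite_induct)
  case empty
  then show ?case by (simp add: face_def transversal_def)
next
  case (insert v c)
  let ?P = "chain_prod (\<lambda>\<alpha>. scale (r \<alpha>) (face {\<alpha>}) + scale (s \<alpha>) (face {bar \<alpha>})) c"
  have v: "v \<notin> c" "bar v \<notin> c" using insert.hyps insert.prems bar_Vdot by auto
  have prod: "(\<Prod>\<alpha>\<in>c. if \<alpha> \<in> z - {v} then r \<alpha> else s \<alpha>) = (\<Prod>\<alpha>\<in>c. if \<alpha> \<in> z then r \<alpha> else s \<alpha>)"
    "(\<Prod>\<alpha>\<in>c. if \<alpha> \<in> z - {bar v} then r \<alpha> else s \<alpha>) = (\<Prod>\<alpha>\<in>c. if \<alpha> \<in> z then r \<alpha> else s \<alpha>)"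
    using v by (auto intro!: prod.cong)
  have fin: "finite z" if "z \<in> transversal (insert v c)"
    using that insert.hyps(1) finite_subset[of z "insert v c \<union> bar ` insert v c"] by (auto simp: transversal_def)
  have xor: "v \<in> z \<longleftrightarrow> bar v \<notin> z" if "z \<in> transversal (insert v c)"
    using that by (auto simp: transversal_def)
  have "chain_prod (\<lambda>\<alpha>. scale (r \<alpha>) (face {\<alpha>}) + scale (s \<alpha>) (face {bar \<alpha>})) (insert v c) z
    = chain_mult (scale (r v) (face {v}) + scale (s v) (face {bar v})) ?P z"
    using insert.hyps by simp
  also have "\<dots> = (if finite z \<and> v \<in> z then r v * ?P (z - {v}) else 0)
      + (if finite z \<and> bar v \<in> z then s v * ?P (z - {bar v}) else 0)"
    by (simp only: chain_mult_lincomb_left) (simp add: chain_mult_face_singleton scale_def)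
  also have "\<dots> = (if z \<in> transversal (insert v c) then \<Prod>\<alpha>\<in>insert v c. if \<alpha> \<in> z then r \<alpha> else s \<alpha> else 0)"
  proof -
    define q where "q = (\<Prod>\<alpha>\<in>c. if \<alpha> \<in> z then r \<alpha> else s \<alpha>)"
    have c: "c \<subseteq> Vdot n" using insert.prems by simp
    have 1: "?P (z - {v}) = (if z \<in> transversal (insert v c) then q else 0)" if "v \<in> z"
      unfolding insert.IH[OF c] prod q_def[symmetric] transversal_insert1[OF v that] ..
    have 2: "?P (z - {bar v}) = (if z \<in> transversal (insert v c) then q else 0)" if "bar v \<in> z"
      unfolding insert.IH[OF c] prod q_def[symmetric] transversal_insert2[OF v that] ..
    have 3: "(\<Prod>\<alpha>\<in>insert v c. if \<alpha> \<in> z then r \<alpha> else s \<alpha>) = (if v \<in> z then r v else s v) * q"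
      using insert.hyps by (simp add: q_def)
    show ?thesis
    proof (cases "z \<in> transversal (insert v c)")
      case True
      then have "finite z" "v \<in> z \<longleftrightarrow> bar v \<notin> z" using fin xor by blast+
      then show ?thesis unfolding 3 using True 1 2 by (cases "v \<in> z") simp_all
    qed (use 1 2 in simp)
  qed
  finally show ?case .
qed

lemma transversalD:
  assumes "z \<in> transversal c"
  shows "v \<in> z \<Longrightarrow> v \<in> c \<or> bar v \<in> c" "v \<in> c \<Longrightarrow> bar v \<in> z \<longleftrightarrow> v \<notin> z"
  using assms by (auto simp: transversal_def)

lemma
  assumes "c \<subseteq> Vdot n" "z \<in> transversal c"
  shows transversal_faces: "z \<in> faces n" and card_transversal: "card z = card c"
proof -
  have b: "bar \<alpha> \<notin> c" if "\<alpha> \<in> c" for \<alpha> using assms(1) that bar_Vdot by blast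
  have z: "z \<subseteq> c \<union> bar ` c" "\<And>\<alpha>. \<alpha> \<in> c \<Longrightarrow> \<alpha> \<in> z \<longleftrightarrow> bar \<alpha> \<notin> z"
    using assms(2) by (auto simp: transversal_def)
  have "bar v \<notin> z" if "v \<in> z" for v
    using z(1) z(2)[of v] z(2)[of "bar v"] that by auto
  moreover have "z \<subseteq> V n" using z(1) assms(1) by (auto simp: V_def)
  ultimately show "z \<in> faces n" by (simp add: faces_iff)
  \<comment> \<open>The vertex that z picks from the pair of \<alpha>; it gives a bijection from c
    to z.\<close>
  define h where "h \<alpha> = (if \<alpha> \<in> z then \<alpha> else bar \<alpha>)" for \<alpha>
  have "inj_on h c" using b by (auto simp: inj_on_def h_def split: if_splits)
  moreover have "h ` c = z"
  proof (intro equalityI subsetI)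
    fix v assume v: "v \<in> z"
    show "v \<in> h ` c"
    proof (cases "v \<in> c")
      case True
      then show ?thesis using v by (auto simp: h_def intro!: image_eqI[of _ _ v])
    next
      case False
      then have "bar v \<in> c" using v z(1) by auto
      then show ?thesis using v z(2)[of "bar v"] by (auto simp: h_def intro!: image_eqI[of _ _ "bar v"])
    qed
  qed (use z(2) in \<open>auto simp: h_def\<close>)
  ultimately show "card z = card c" using card_image by blast
qed

lemma face_transversal:
  assumes "z \<in> faces n"
  shows "\<exists>c\<subseteq>Vdot n. z \<in> transversal c"
proof (intro exI conjI)
  show "z \<in> transversal {\<alpha> \<in> Vdot n. \<alpha> \<in> z \<or> bar \<alpha> \<in> z}"
    using assms by (auto simp: transversal_def faces_iff V_def)
qed auto

section \<open>The spaces of the brackets as eigenspaces\<close>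

lemma bracket_apply:
  assumes "a \<subseteq> Vdot n" "b \<subseteq> Vdot n" "a \<inter> b = {}"
  shows "bracket a b z = (if z \<in> transversal (a \<union> b)
    then \<Prod>\<alpha>\<in>a \<union> b. if \<alpha> \<in> z then 1 else if \<alpha> \<in> b then - 1 else 1 else (0::'a::field))"
proof -
  have fin: "finite a" "finite b" using assms finite_Vdot finite_subset by blast+
  have "(bracket a b :: 'a chain) = chain_prod (\<lambda>\<alpha>. scale ((\<lambda>_. 1) \<alpha>) (face {\<alpha>})
      + scale (if \<alpha> \<in> b then - 1 else 1) (face {bar \<alpha>})) (a \<union> b)"
    unfolding bracket_def chain_mult_chain_prod[OF fin assms(3)]
    using fin by (intro chain_prod_cong) auto
  then show ?thesis
    using fin assms chain_prod_apply[of "a \<union> b" n "\<lambda>_. 1 :: 'a" "\<lambda>\<alpha>. if \<alpha> \<in> b then - 1 else 1" z] by simp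
qed

lemma bracket_M:
  assumes "a \<subseteq> Vdot n" "b \<subseteq> Vdot n" "a \<inter> b = {}"
  shows "(bracket a b :: 'a::field chain) \<in> M n (card a + card b)"
proof -
  have "finite a" "finite b" using assms finite_Vdot finite_subset by blast+
  then have "card (a \<union> b) = card a + card b" using assms(3) by (simp add: card_Un_disjoint)
  then show ?thesis
    using transversal_faces[of "a \<union> b" n] card_transversal[of "a \<union> b" n] assms(1,2)
    by (auto simp: M_iff bracket_apply[OF assms])
qed

lemma flip_transversal:
  assumes "\<alpha> \<in> Vdot n" "c \<subseteq> Vdot n"
  shows "flip \<alpha> ` z \<in> transversal c \<longleftrightarrow> z \<in> transversal c"
proof -
  have imp: "flip \<alpha> ` z \<in> transversal c" if z: "z \<in> transversal c" for z
  proof (cases "\<alpha> \<in> c")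
    case False
    have "bar \<alpha> \<notin> c" using assms bar_Vdot by blast
    then have "\<alpha> \<notin> z" "bar \<alpha> \<notin> z"
      using False transversalD(1)[OF z] bar_bar by metis+
    then show ?thesis using z by (simp add: flip_image_id)
  next
    case True
    have ne: "\<beta> \<noteq> bar \<alpha>" "\<alpha> \<noteq> bar \<beta>" if "\<beta> \<in> c" for \<beta>
      using that assms bar_Vdot by auto
    consider "\<alpha> \<in> z" "bar \<alpha> \<notin> z" | "\<alpha> \<notin> z" "bar \<alpha> \<in> z"
      using z True by (auto simp: transversal_def)
    then show ?thesis
    proof cases
      case 1
      then have "flip \<alpha> ` z = insert (bar \<alpha>) (z - {\<alpha>})" by (simp add: flip_image)
      then show ?thesis using z True 1 ne by (auto simp: transversal_def)
    next
      case 2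
      then have "flip \<alpha> ` z = insert \<alpha> (z - {bar \<alpha>})"
        using flip_image[of "bar \<alpha>" z] by simp
      then show ?thesis using z True 2 ne by (auto simp: transversal_def)
    qed
  qed
  have "flip \<alpha> ` flip \<alpha> ` z = z" by (simp add: image_comp)
  then show ?thesis using imp[of z] imp[of "flip \<alpha> ` z"] by auto
qed

text \<open>The flip exchanges the two terms of the factor at \<alpha>: a factor \<alpha> -
  \<open>bar \<alpha>\<close> changes sign, a factor \<alpha> + \<open>bar \<alpha>\<close> does
  not, and all other factors are fixed.\<close>

lemma act_flip_bracket:
  assumes ab: "a \<subseteq> Vdot n" "b \<subseteq> Vdot n" "a \<inter> b = {}" and \<alpha>: "\<alpha> \<in> Vdot n"
  shows "act n (flip \<alpha>) (bracket a b) = scale (if \<alpha> \<in> b then - 1 else 1) (bracket a b :: 'a::field chain)"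
proof
  fix z
  have fin: "finite (a \<union> b)" using ab finite_Vdot finite_subset by blast
  have \<alpha>V: "\<alpha> \<in> V n" using \<alpha> by (simp add: V_def)
  have ab': "a \<union> b \<subseteq> Vdot n" using ab by blast
  show "act n (flip \<alpha>) (bracket a b) z = scale (if \<alpha> \<in> b then - 1 else 1) (bracket a b :: 'a chain) z"
  proof (cases "z \<in> transversal (a \<union> b)")
    case False
    then show ?thesis
      by (simp add: act_flip[OF \<alpha>V] bracket_apply[OF ab] flip_transversal[OF \<alpha> ab'] scale_def)
  next
    case True
    let ?s = "\<lambda>z \<beta>. if \<beta> \<in> z then 1 else if \<beta> \<in> b then - 1 else 1 :: 'a"
    have mem: "\<beta> \<in> flip \<alpha> ` z \<longleftrightarrow> \<beta> \<in> z" if "\<beta> \<in> a \<union> b" "\<beta> \<noteq> \<alpha>" for \<beta>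
    proof -
      have "\<beta> \<noteq> bar \<alpha>" using that ab' bar_Vdot[OF \<alpha>] by blast
      then show ?thesis using that(2) by (auto simp: transpose_def image_iff split: if_splits)
    qed
    have mem\<alpha>: "\<alpha> \<in> flip \<alpha> ` z \<longleftrightarrow> bar \<alpha> \<in> z"
      by (auto simp: transpose_def image_iff split: if_splits)
    have "(\<Prod>\<beta>\<in>a \<union> b. ?s (flip \<alpha> ` z) \<beta>) = (if \<alpha> \<in> b then - 1 else 1) * (\<Prod>\<beta>\<in>a \<union> b. ?s z \<beta>)"
    proof (cases "\<alpha> \<in> a \<union> b")
      case \<alpha>c: True
      have "\<alpha> \<in> z \<longleftrightarrow> bar \<alpha> \<notin> z" using transversalD(2)[OF True \<alpha>c] by blast
      then have 1: "?s (flip \<alpha> ` z) \<alpha> = (if \<alpha> \<in> b then - 1 else 1) * ?s z \<alpha>" using mem\<alpha> by auto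
      have 2: "(\<Prod>\<beta>\<in>a \<union> b - {\<alpha>}. ?s (flip \<alpha> ` z) \<beta>) = (\<Prod>\<beta>\<in>a \<union> b - {\<alpha>}. ?s z \<beta>)"
      proof (intro prod.cong refl)
        fix \<beta> assume "\<beta> \<in> a \<union> b - {\<alpha>}"
        then have "\<beta> \<in> flip \<alpha> ` z \<longleftrightarrow> \<beta> \<in> z" using mem by blast
        then show "?s (flip \<alpha> ` z) \<beta> = ?s z \<beta>" by (simp only:)
      qed
      show ?thesis
        unfolding prod.remove[OF fin \<alpha>c, of "?s (flip \<alpha> ` z)"] prod.remove[OF fin \<alpha>c, of "?s z"] 1 2 mult.assoc ..
    next
      case False
      have "(\<Prod>\<beta>\<in>a \<union> b. ?s (flip \<alpha> ` z) \<beta>) = (\<Prod>\<beta>\<in>a \<union> b. ?s z \<beta>)"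
      proof (intro prod.cong refl)
        fix \<beta> assume "\<beta> \<in> a \<union> b"
        then have "\<beta> \<in> flip \<alpha> ` z \<longleftrightarrow> \<beta> \<in> z" using mem False by metis
        then show "?s (flip \<alpha> ` z) \<beta> = ?s z \<beta>" by (simp only:)
      qed
      then show ?thesis using False by simp
    qed
    then show ?thesis
      using True transversal_faces[OF ab' True]
      by (simp add: act_flip[OF \<alpha>V] bracket_apply[OF ab] flip_transversal[OF \<alpha> ab'] scale_def)
  qed
qed

lemma flip_sum_bracket:
  assumes "a \<subseteq> Vdot n" "b \<subseteq> Vdot n" "a \<inter> b = {}"
  shows "flip_sum n (bracket a b) = scale (of_int (int n - 2 * int (card b))) (bracket a b :: 'a::field chain)"
proof -
  have "(\<Sum>\<alpha>\<in>Vdot n. if \<alpha> \<in> b then - 1 else 1 :: int) = (\<Sum>\<alpha>\<in>Vdot n. 1 - 2 * (if \<alpha> \<in> b then 1 else 0))"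
    by (intro sum.cong) auto
  also have "\<dots> = int n - 2 * (\<Sum>\<alpha>\<in>Vdot n. if \<alpha> \<in> b then 1 else 0)"
    by (simp add: sum_subtractf sum_distrib_left)
  also have "(\<Sum>\<alpha>\<in>Vdot n. if \<alpha> \<in> b then 1 else 0 :: int) = int (card b)"
    using assms(2) by (simp add: sum.If_cases Int_absorb1)
  finally have s: "(\<Sum>\<alpha>\<in>Vdot n. if \<alpha> \<in> b then - 1 else 1 :: int) = int n - 2 * int (card b)" .
  have "flip_sum n (bracket a b) = (\<Sum>\<alpha>\<in>Vdot n. scale (of_int (if \<alpha> \<in> b then - 1 else 1)) (bracket a b :: 'a chain))"
    unfolding flip_sum_def
  proof (intro sum.cong refl)
    fix \<alpha> assume \<alpha>: "\<alpha> \<in> Vdot n"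
    show "act n (flip \<alpha>) (bracket a b) = scale (of_int (if \<alpha> \<in> b then - 1 else 1)) (bracket a b :: 'a chain)"
      unfolding act_flip_bracket[OF assms \<alpha>] by (cases "\<alpha> \<in> b") simp_all
  qed
  also have "\<dots> = scale (of_int (\<Sum>\<alpha>\<in>Vdot n. if \<alpha> \<in> b then - 1 else 1)) (bracket a b)"
    unfolding of_int_sum by (rule chain.scale_sum_left[symmetric])
  finally show ?thesis unfolding s .
qed

text \<open>An eigenspace is a subspace, so testing the generators is enough. The reverse inclusion
  is \<open>E2_eq\<close> and needs the brackets to span.\<close>

lemma E2_subset:
  "E2 n k j \<subseteq> {f \<in> M n k. flip_sum n f = scale (of_int (int n - 2 * int j)) (f :: 'a::field chain)}"
  unfolding E2_def
proof (rule chain.span_minimal)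
  show "{bracket a b |a b. a \<subseteq> Vdot n \<and> b \<subseteq> Vdot n \<and> a \<inter> b = {} \<and> int (card a) = int k - int j \<and> card b = j}
    \<subseteq> {f \<in> M n k. flip_sum n f = scale (of_int (int n - 2 * int j)) (f :: 'a chain)}"
  proof clarify
    fix a b assume ab: "a \<subseteq> Vdot n" "b \<subseteq> Vdot n" "a \<inter> b = {}" and c: "int (card a) = int k - int (card b)"
    have "k = card a + card b" using c by linarith
    then show "bracket a b \<in> M n k \<and> flip_sum n (bracket a b)
        = scale (of_int (int n - 2 * int (card b))) (bracket a b :: 'a chain)"
      using bracket_M[OF ab] flip_sum_bracket[OF ab] by blast
  qed
qed (intro subspace_eigen linear_flip_sum subspace_M)

text \<open>A negative \<open>card a\<close> is impossible, so there are no generators. This is why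
  \<open>bd\<close> vanishes on the level k = j.\<close>

lemma E2_eq_0:
  assumes "k < j"
  shows "E2 n k j = {0 :: 'a::field chain}"
proof -
  have "{bracket a b :: 'a chain |a b. a \<subseteq> Vdot n \<and> b \<subseteq> Vdot n \<and> a \<inter> b = {} \<and>
      int (card a) = int k - int j \<and> card b = j} = {}"
    using assms by auto
  then show ?thesis unfolding E2_def by (simp only: chain.span_empty)
qed

lemma subspace_E2: "chain.subspace (E2 n k j)"
  by (simp add: E2_def)

text \<open>Multilinear expansion: every factor is a combination of P and Q, and the subset b
  records where Q is taken.\<close>

lemma chain_prod_span:
  assumes "finite c" "\<And>v. v \<in> c \<Longrightarrow> \<exists>p q. F v = scale p (P v) + scale q (Q v :: 'a::field chain)"
  shows "chain_prod F c \<in> chain.span ((\<lambda>b. chain_prod (\<lambda>v. if v \<in> b then Q v else P v) c) ` Pow c)"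
  using assms
proof (induction c rule: finite_induct)
  case (insert v c)
  let ?B = "\<lambda>c. (\<lambda>b. chain_prod (\<lambda>v. if v \<in> b then Q v else P v) c) ` Pow c"
  obtain p q where F: "F v = scale p (P v) + scale q (Q v)" using insert.prems by blast
  have IH: "chain_prod F c \<in> chain.span (?B c)" using insert by blast
  \<comment> \<open>Multiplication by a fixed chain is linear, so it suffices to see where the
    generators for c go.\<close>
  have sp: "chain_mult X (chain_prod F c) \<in> chain.span (?B (insert v c))"
    if X: "\<And>b. b \<subseteq> c \<Longrightarrow> chain_mult X (chain_prod (\<lambda>v. if v \<in> b then Q v else P v) c) \<in> ?B (insert v c)" for X
  proof -
    have "chain_mult X ` chain.span (?B c) = chain.span (chain_mult X ` ?B c)"
      by (rule module_hom.span_image[symmetric])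
        (use linear_chain_mult in \<open>auto simp: Vector_Spaces.linear_def\<close>)
    also have "\<dots> \<subseteq> chain.span (?B (insert v c))"
      using X by (intro chain.span_mono) auto
    finally show ?thesis using IH by blast
  qed
  have P: "chain_mult (P v) (chain_prod F c) \<in> chain.span (?B (insert v c))"
  proof (rule sp)
    fix b assume "b \<subseteq> c"
    then have "chain_mult (P v) (chain_prod (\<lambda>v. if v \<in> b then Q v else P v) c)
        = chain_prod (\<lambda>v. if v \<in> b then Q v else P v) (insert v c)"
      using insert.hyps by (simp add: subset_iff) blast
    then show "chain_mult (P v) (chain_prod (\<lambda>v. if v \<in> b then Q v else P v) c) \<in> ?B (insert v c)"
      using \<open>b \<subseteq> c\<close> by blast
  qed
  have Q: "chain_mult (Q v) (chain_prod F c) \<in> chain.span (?B (insert v c))"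
  proof (rule sp)
    fix b assume "b \<subseteq> c"
    then have "chain_mult (Q v) (chain_prod (\<lambda>v. if v \<in> b then Q v else P v) c)
        = chain_prod (\<lambda>w. if w \<in> insert v b then Q w else P w) (insert v c)"
      using insert.hyps by (simp, intro arg_cong[where f = "chain_mult (Q v)"] chain_prod_cong) auto
    then show "chain_mult (Q v) (chain_prod (\<lambda>v. if v \<in> b then Q v else P v) c) \<in> ?B (insert v c)"
      using \<open>b \<subseteq> c\<close> by blast
  qed
  have FI: "chain_prod F (insert v c)
      = scale p (chain_mult (P v) (chain_prod F c)) + scale q (chain_mult (Q v) (chain_prod F c))"
    by (simp only: chain_prod_insert[OF insert.hyps] F chain_mult_lincomb_left)
  show ?case unfolding FI by (intro chain.span_add chain.span_scale P Q)
qed (simp add: chain.span_base)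

text \<open>One condition for all divisions below: for n > 0 it says that 2 and 1, ..., n are
  nonzero in the field, for n = 0 it is vacuous. It is phrased over the integers because the
  eigenvalues are computed there.\<close>

locale large_characteristic =
  fixes n :: nat and field_type :: "'a::field itself"
  assumes two_times_neq_0: "\<And>x::int. 0 < x \<Longrightarrow> x \<le> int n \<Longrightarrow> of_int (2 * x) \<noteq> (0::'a)"
begin

lemma two_times_eq_iff: "\<bar>x - y\<bar> \<le> int n \<Longrightarrow> of_int (2 * x) = (of_int (2 * y) :: 'a) \<longleftrightarrow> x = y"
proof
  assume *: "\<bar>x - y\<bar> \<le> int n" "of_int (2 * x) = (of_int (2 * y) :: 'a)"
  have "of_int (2 * (x - y)) = of_int (2 * x) - (of_int (2 * y) :: 'a)"
    "of_int (2 * (y - x)) = of_int (2 * y) - (of_int (2 * x) :: 'a)"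
    by (simp_all add: algebra_simps)
  then have "of_int (2 * (x - y)) = (0::'a)" "of_int (2 * (y - x)) = (0::'a)"
    unfolding *(2) by (simp_all only: diff_self)
  then have "\<not> 0 < x - y" "\<not> 0 < y - x"
    using two_times_neq_0[of "x - y"] two_times_neq_0[of "y - x"] * by linarith+
  then show "x = y" by linarith
qed simp

text \<open>A face is the product of its vertices, and each vertex is half the sum or half the
  difference of \<alpha> + \<open>bar \<alpha>\<close> and \<alpha> - \<open>bar \<alpha>\<close>.
  Expanding the product gives brackets; this is where 2 must be invertible.\<close>

lemma face_in_span:
  assumes "z \<in> faces n" "card z = k"
  shows "(face z :: 'a chain) \<in> chain.span (\<Union>j\<le>k. {bracket a b | a b.
     a \<subseteq> Vdot n \<and> b \<subseteq> Vdot n \<and> a \<inter> b = {} \<and> int (card a) = int k - int j \<and> card b = j})"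
    (is "_ \<in> chain.span ?S")
proof -
  obtain c where c: "c \<subseteq> Vdot n" "z \<in> transversal c" using face_transversal[OF assms(1)] by blast
  have fin: "finite c" using c finite_Vdot finite_subset by blast
  have cardc: "card c = k" using card_transversal[OF c] assms(2) by simp
  \<comment> \<open>The vertex of z in the pair of \<alpha>, written as a linear form so that
    \<open>chain_prod_apply\<close> gives the coefficients of the product.\<close>
  define F :: "vertex \<Rightarrow> 'a chain" where "F = (\<lambda>\<alpha>. scale (if \<alpha> \<in> z then 1 else 0) (face {\<alpha>})
      + scale (if \<alpha> \<in> z then 0 else 1) (face {bar \<alpha>}))"
  have "face z = chain_prod F c"
  proof
    fix y
    have "(\<Prod>\<alpha>\<in>c. if \<alpha> \<in> y then if \<alpha> \<in> z then 1 else 0 else if \<alpha> \<in> z then 0 else 1)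
        = (if y = z then 1 else 0 :: 'a)" if y: "y \<in> transversal c"
    proof (cases "y = z")
      case False
      have "\<exists>\<alpha>\<in>c. \<alpha> \<in> y \<longleftrightarrow> \<alpha> \<notin> z"
      proof (rule ccontr)
        assume "\<not> (\<exists>\<alpha>\<in>c. \<alpha> \<in> y \<longleftrightarrow> \<alpha> \<notin> z)"
        then have eq: "\<And>\<alpha>. \<alpha> \<in> c \<Longrightarrow> \<alpha> \<in> y \<longleftrightarrow> \<alpha> \<in> z" by blast
        have "v \<in> y \<longleftrightarrow> v \<in> z" for v
          using eq[of v] eq[of "bar v"] transversalD[OF y, of v] transversalD[OF c(2), of v]
            transversalD(2)[OF y, of "bar v"] transversalD(2)[OF c(2), of "bar v"]
          unfolding bar_bar by blast
        then show False using False by blast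
      qed
      then obtain \<alpha> where \<alpha>: "\<alpha> \<in> c" "\<alpha> \<in> y \<longleftrightarrow> \<alpha> \<notin> z" by blast
      then have "(if \<alpha> \<in> y then if \<alpha> \<in> z then 1 else 0 else if \<alpha> \<in> z then 0 else 1) = (0 :: 'a)"
        by (cases "\<alpha> \<in> z") simp_all
      then have "(\<Prod>\<alpha>\<in>c. if \<alpha> \<in> y then if \<alpha> \<in> z then 1 else 0 else if \<alpha> \<in> z then 0 else 1) = (0 :: 'a)"
        by (intro prod_zero[OF fin] bexI[OF _ \<alpha>(1)])
      then show ?thesis using False by simp
    qed (auto intro!: prod.neutral)
    moreover have "chain_prod F c y = (if y \<in> transversal c
        then \<Prod>\<alpha>\<in>c. if \<alpha> \<in> y then if \<alpha> \<in> z then 1 else 0 else if \<alpha> \<in> z then 0 else 1 else 0)"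
      unfolding F_def by (rule chain_prod_apply[OF fin c(1)])
    ultimately show "face z y = chain_prod F c y"
      using c(2) by (cases "y = z") (simp_all add: face_def)
  qed
  also have "chain_prod F c \<in> chain.span ((\<lambda>b. chain_prod (\<lambda>v. if v \<in> b then face {v} - face {bar v}
      else face {v} + face {bar v}) c) ` Pow c)"
  proof (rule chain_prod_span[OF fin])
    fix v assume "v \<in> c"
    \<comment> \<open>A nonempty c forces n > 0, so that the locale assumption at x = 1 yields 2
      \<noteq> 0.\<close>
    then have "n > 0" using c(1) by (cases n) (auto simp: Vdot_def)
    then have two: "(2::'a) \<noteq> 0" using two_times_neq_0[of 1] by simp
    have "F v = scale (1/2) (face {v} + face {bar v})
        + scale (if v \<in> z then 1/2 else - 1/2) (face {v} - face {bar v})"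
      using two by (auto simp: F_def fun_eq_iff scale_def field_simps)
    then show "\<exists>p q. F v = scale p (face {v} + face {bar v}) + scale q (face {v} - face {bar v})" by blast
  qed
  also have "chain.span ((\<lambda>b. chain_prod (\<lambda>v. if v \<in> b then face {v} - face {bar v}
      else face {v} + face {bar v}) c) ` Pow c) \<subseteq> chain.span ?S"
  proof (rule chain.span_mono, rule image_subsetI)
    fix b assume "b \<in> Pow c"
    then have b: "b \<subseteq> c" by simp
    have fb: "finite b" "finite (c - b)" using b fin finite_subset by auto
    have cb: "c - b \<union> b = c" "(c - b) \<inter> b = {}" using b by blast+
    have "bracket (c - b) b = chain_prod (\<lambda>v. if v \<in> b then face {v} - face {bar v}
      else face {v} + face {bar v} :: 'a chain) c"
      unfolding bracket_def chain_mult_chain_prod[OF fb(2,1) cb(2)] cb(1) ..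
    moreover have "card b \<le> k" using b fin cardc card_mono by blast
    moreover have "int (card (c - b)) = int k - int (card b)"
      using b fin fb cardc calculation(2) by (simp add: card_Diff_subset of_nat_diff)
    ultimately show "chain_prod (\<lambda>v. if v \<in> b then face {v} - face {bar v}
      else face {v} + face {bar v} :: 'a chain) c \<in> ?S"
      using b c(1) by (intro UN_I[of "card b"] CollectI exI[of _ "c - b"] exI[of _ b]) auto
  qed
  finally show ?thesis .
qed

lemma M_decomp:
  assumes "f \<in> M n k"
  shows "\<exists>v. (\<forall>j\<le>k. v j \<in> E2 n k j) \<and> f = (\<Sum>j\<le>k. v j :: 'a chain)"
proof -
  have "f y = (\<Sum>z\<in>L n k. scale (f z) (face z)) y" for y
  proof -
    have "finite (L n k)" by (rule finite_subset[OF _ finite_faces[of n]]) (auto simp: L_iff)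
    moreover have "f z * (if y = z then 1 else 0) = (if y = z then f y else 0)" for z by auto
    ultimately show ?thesis using assms by (auto simp: sum_chain_apply scale_def face_def M_def)
  qed
  then have "f = (\<Sum>z\<in>L n k. scale (f z) (face z))" by blast
  also have "\<dots> \<in> chain.span (\<Union>j\<le>k. {bracket a b | a b.
     a \<subseteq> Vdot n \<and> b \<subseteq> Vdot n \<and> a \<inter> b = {} \<and> int (card a) = int k - int j \<and> card b = j})"
    by (intro chain.span_sum chain.span_scale face_in_span) (auto simp: L_iff)
  finally have "f \<in> chain.span (\<Union>j\<le>k. {bracket a b | a b.
     a \<subseteq> Vdot n \<and> b \<subseteq> Vdot n \<and> a \<inter> b = {} \<and> int (card a) = int k - int j \<and> card b = j})" .
  from span_UN_sums[OF finite_atMost this] show ?thesis by (simp only: E2_def Ball_def atMost_iff)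
qed

lemma inj_flip_eigenvalue: "inj_on (\<lambda>j. of_int (int n - 2 * int j) :: 'a) {..n}"
proof (rule inj_onI)
  fix i j assume "i \<in> {..n}" "j \<in> {..n}" "of_int (int n - 2 * int i) = (of_int (int n - 2 * int j) :: 'a)"
  then show "i = j" using two_times_eq_iff[of "int i" "int j"] by simp
qed

text \<open>By \<open>M_decomp\<close> an element of \<open>M n k\<close> is a sum of eigenvectors
  of T for the eigenvalues n - 2t. These are distinct in the field for t \<le> n, so in an
  eigenvector only one component survives. Closure of \<open>E2\<close> under \<open>eps\<close>,
  \<open>bd\<close> and the group then follows without computing with brackets.\<close>

lemma E2_eq:
  assumes "k \<le> n" "j \<le> n"
  shows "(E2 n k j :: 'a chain set) = {f \<in> M n k. flip_sum n f = scale (of_int (int n - 2 * int j)) f}"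
proof (rule equalityI[OF E2_subset], clarify)
  fix f :: "'a chain" assume f: "f \<in> M n k" and Tf: "flip_sum n f = scale (of_int (int n - 2 * int j)) f"
  obtain v where v: "\<And>j. j \<le> k \<Longrightarrow> v j \<in> E2 n k j" and fv: "f = (\<Sum>j\<le>k. v j)"
    using M_decomp[OF f] by blast
  \<comment> \<open>The indices are extended from t \<le> k to t \<le> n by zero components, so that
    j is an index even if j > k.\<close>
  have "f = (if j \<le> k then v j else 0)"
  proof (rule eigen_component[OF linear_flip_sum finite_atMost inj_flip_eigenvalue _ _ Tf])
    show "f = (\<Sum>t\<le>n. if t \<le> k then v t else 0)"
      unfolding fv using assms(1) by (intro sum.mono_neutral_cong_left) auto
    fix t
    have "flip_sum n (v t) = scale (of_int (int n - 2 * int t)) (v t)" if "t \<le> k"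
      using v[OF that] E2_subset by blast
    then show "flip_sum n (if t \<le> k then v t else 0)
        = scale (of_int (int n - 2 * int t)) (if t \<le> k then v t else 0)"
      by (cases "t \<le> k") (simp_all only: if_True if_False linear_map_0[OF linear_flip_sum] chain.scale_zero_right)
  qed (use assms in auto)
  then show "f \<in> E2 n k j" using v[of j] chain.subspace_0[OF subspace_E2] by auto
qed

end

section \<open>Raising, lowering and the eigenvalues\<close>

lemma scale_eq_add: "f - g = scale a h \<Longrightarrow> f = g + scale a (h :: 'a::field chain)"
  by (simp add: algebra_simps)

lemma linear_nu_plus: "linear_map (nu_plus n)"
  by (rule linear_mapI)
    (simp_all only: nu_plus_def linear_map_add[OF linear_eps] linear_map_add[OF linear_bd]
      linear_map_scale[OF linear_eps] linear_map_scale[OF linear_bd])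

definition eigenvalue :: "nat \<Rightarrow> nat \<Rightarrow> nat \<Rightarrow> nat \<Rightarrow> int" where
  "eigenvalue n k j i = 2 * (int k - int j + 1 - int i) * (int n - int k - int i)"

lemma E3_iff: "f \<in> E3 n k j i \<longleftrightarrow> f \<in> E2 n k j \<and> bd n (eps n f) = scale (of_int (eigenvalue n k j i)) f"
  by (simp add: E3_def nu_plus_def eigenvalue_def)

lemma subspace_E3: "chain.subspace (E3 n k j i)"
  unfolding E3_def by (intro subspace_eigen linear_nu_plus subspace_E2)

text \<open>The increment is the commutator scalar of level s + 1. This is what lets the label i
  survive a move between levels.\<close>

lemma eigenvalue_Suc:
  "eigenvalue n (Suc s) j i = eigenvalue n s j i + 2 * (int n + int j - 2 * int (Suc s))"
  by (simp add: eigenvalue_def algebra_simps)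

text \<open>For fixed s and j the eigenvalue is a quadratic polynomial in i, symmetric under i
  \<mapsto> n - j + 1 - i; the symmetry gives the second factor.\<close>

lemma eigenvalue_diff:
  "eigenvalue n s j i - eigenvalue n s j i' = - (2 * (int i - int i') * (int n - int j + 1 - int i - int i'))"
  by (simp add: eigenvalue_def algebra_simps)

lemma E2_M: "f \<in> E2 n k j \<Longrightarrow> f \<in> M n k"
  using E2_subset by blast

lemma E2_commutator:
  assumes "f \<in> E2 n s j"
  shows "bd n (eps n f) = eps n (bd n f) + scale (of_int (2 * (int n + int j - 2 * int s))) (f :: 'a::field chain)"
proof (rule scale_eq_add)
  have "flip_sum n f = scale (of_int (int n - 2 * int j)) f" using assms E2_subset by blast
  then have "bd n (eps n f) - eps n (bd n f)
      = scale (of_int (3 * int n - 4 * int s)) f - scale (of_int (int n - 2 * int j)) f"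
    using commutator[OF E2_M[OF assms]] by simp
  also have "\<dots> = scale (of_int (2 * (int n + int j - 2 * int s))) f"
    unfolding chain.scale_left_diff_distrib[symmetric] of_int_diff[symmetric] by (simp add: algebra_simps)
  finally show "bd n (eps n f) - eps n (bd n f) = scale (of_int (2 * (int n + int j - 2 * int s))) f" .
qed

lemma E2_top: "f \<in> E2 n n j \<Longrightarrow> eps n (f :: 'a::field chain) = 0"
  using M_eq_0[OF eps_M[OF E2_M]] by blast

text \<open>On a fixed level T is a scalar minus the commutator of \<open>bd\<close> and
  \<open>eps\<close>, and both of these commute with g. This replaces conjugating the flips by
  g.\<close>

lemma act_flip_sum:
  assumes "g \<in> carrier (hyperoct n)" "f \<in> M n k"
  shows "act n g (flip_sum n f) = flip_sum n (act n g f :: 'a::field chain)"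
proof -
  have c: "flip_sum n f = scale (of_int (3 * int n - 4 * int k)) f - (bd n (eps n f) - eps n (bd n f))"
    if "f \<in> M n k" for f :: "'a chain"
    unfolding commutator[OF that] by simp
  show ?thesis
    unfolding c[OF assms(2)] c[OF act_M[OF assms]] linear_map_diff[OF linear_act]
      linear_map_scale[OF linear_act] act_bd[OF assms(1)] act_eps[OF assms(1)] ..
qed

section \<open>Moves between neighbouring levels\<close>

context large_characteristic
begin

lemma E2_eps:
  assumes "j \<le> n" "s < n" "f \<in> E2 n s j"
  shows "eps n (f :: 'a chain) \<in> E2 n (Suc s) j"
  using assms by (auto simp: E2_eq eps_M flip_sum_eps linear_map_scale[OF linear_eps])

lemma E2_bd:
  assumes "j \<le> n" "s < n" "f \<in> E2 n (Suc s) j"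
  shows "bd n (f :: 'a chain) \<in> E2 n s j"
  using assms by (auto simp: E2_eq bd_M flip_sum_bd linear_map_scale[OF linear_bd])

text \<open>\<open>bd\<close> keeps j but leads to level j - 1, where \<open>E2\<close> is zero; for
  j = 0 there is no lower level.\<close>

lemma E2_bd_bottom:
  assumes "j \<le> n" "f \<in> E2 n j j"
  shows "bd n (f :: 'a chain) = 0"
proof (cases j)
  case 0
  then show ?thesis using E2_M[OF assms(2)] by (simp add: M_0_bd)
next
  case (Suc j')
  then have "bd n f \<in> E2 n j' j" using assms by (intro E2_bd) auto
  then show ?thesis using E2_eq_0[of j' j] Suc by auto
qed

text \<open>For \<open>eps n f\<close> the commutator relation adds its scalar to the eigenvalue of
  f, and \<open>eigenvalue_Suc\<close> recognizes the sum as the eigenvalue of the next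
  level.\<close>

lemma E3_eps:
  assumes "j \<le> n" "s < n" "f \<in> E3 n s j i"
  shows "eps n (f :: 'a chain) \<in> E3 n (Suc s) j i"
proof -
  have f: "f \<in> E2 n s j" "bd n (eps n f) = scale (of_int (eigenvalue n s j i)) f"
    using assms(3) by (auto simp: E3_iff)
  have e: "eps n f \<in> E2 n (Suc s) j" using E2_eps assms(1,2) f(1) .
  have "bd n (eps n (eps n f)) = scale (of_int (eigenvalue n (Suc s) j i)) (eps n f)"
    unfolding E2_commutator[OF e] f(2) linear_map_scale[OF linear_eps] eigenvalue_Suc
      chain.scale_left_distrib[symmetric] of_int_add[symmetric] ..
  then show ?thesis using e by (simp add: E3_iff)
qed

text \<open>Here the relation is solved for \<open>eps n (bd n f)\<close>: subtracting the scalar of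
  level s + 1 leaves the eigenvalue of level s. Hence both composites between the two levels are the
  same scalar.\<close>

lemma E3_bd:
  assumes "j \<le> n" "s < n" "f \<in> E3 n (Suc s) j i"
  shows "bd n (f :: 'a chain) \<in> E3 n s j i" "eps n (bd n f) = scale (of_int (eigenvalue n s j i)) f"
proof -
  have f: "f \<in> E2 n (Suc s) j" "bd n (eps n f) = scale (of_int (eigenvalue n (Suc s) j i)) f"
    using assms(3) by (auto simp: E3_iff)
  have "eps n (bd n f) = bd n (eps n f) - scale (of_int (2 * (int n + int j - 2 * int (Suc s)))) f"
    unfolding E2_commutator[OF f(1)] by (rule add_diff_cancel_right'[symmetric])
  also have "\<dots> = scale (of_int (eigenvalue n s j i)) f"
    unfolding f(2) chain.scale_left_diff_distrib[symmetric] of_int_diff[symmetric] eigenvalue_Suc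
      add_diff_cancel_right' ..
  finally show e: "eps n (bd n f) = scale (of_int (eigenvalue n s j i)) f" .
  show "bd n f \<in> E3 n s j i"
    unfolding E3_iff e linear_map_scale[OF linear_bd] using E2_bd assms(1,2) f(1) by auto
qed

lemma E3_act:
  assumes "g \<in> carrier (hyperoct n)" "k \<le> n" "j \<le> n" "f \<in> E3 n k j i"
  shows "act n g (f :: 'a chain) \<in> E3 n k j i"
proof -
  have f: "f \<in> M n k" "flip_sum n f = scale (of_int (int n - 2 * int j)) f"
    "bd n (eps n f) = scale (of_int (eigenvalue n k j i)) f"
    using assms by (auto simp: E3_iff E2_eq)
  then have "act n g f \<in> E2 n k j"
    using assms(1-3) by (auto simp: E2_eq act_M linear_map_scale[OF linear_act] simp flip: act_flip_sum[OF _ f(1)])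
  then show ?thesis
    unfolding E3_iff act_eps[OF assms(1), symmetric] act_bd[OF assms(1), symmetric] f(3)
      linear_map_scale[OF linear_act] by blast
qed

section \<open>Nonzero and distinct eigenvalues\<close>

lemma of_int_neq_0: "0 < x \<Longrightarrow> x \<le> int n \<Longrightarrow> of_int x \<noteq> (0::'a)"
  using two_times_neq_0[of x] by auto

text \<open>In this range both s - j + 1 - i and n - s - i lie between 1 and n.\<close>

lemma eigenvalue_neq_0:
  assumes "j + i \<le> s" "s < n - i"
  shows "of_int (eigenvalue n s j i) \<noteq> (0::'a)"
  unfolding eigenvalue_def of_int_mult[of "2 * _"]
  using assms by (intro no_zero_divisors two_times_neq_0 of_int_neq_0) linarith+

text \<open>The bound on i + i' keeps the second factor of \<open>eigenvalue_diff\<close> positive,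
  which excludes the mirror image i' = n - j + 1 - i.\<close>

lemma eigenvalue_eq_iff:
  assumes "i + i' \<le> n - j" "j \<le> n"
  shows "of_int (eigenvalue n s j i) = (of_int (eigenvalue n s j i') :: 'a) \<longleftrightarrow> i = i'"
proof
  assume eq: "of_int (eigenvalue n s j i) = (of_int (eigenvalue n s j i') :: 'a)"
  have *: "of_int (2 * (int i - int i')) * of_int (int n - int j + 1 - int i - int i') = (0::'a)"
  proof -
    have "of_int (eigenvalue n s j i - eigenvalue n s j i') = (0::'a)"
      unfolding of_int_diff eq by (rule diff_self)
    then show ?thesis unfolding eigenvalue_diff of_int_minus of_int_mult[of "2 * _"] by (simp only: neg_equal_0_iff_equal)
  qed
  show "i = i'"
  proof (rule ccontr)
    assume ne: "i \<noteq> i'"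
    \<comment> \<open>As i and i' differ, i + i' is at least 1, so this factor is at most n. The
      value n + 1, which may be 0 in the field, could arise only for i = i' = 0.\<close>
    then have "of_int (int n - int j + 1 - int i - int i') \<noteq> (0::'a)"
      using assms by (intro of_int_neq_0) linarith+
    with * have "of_int (2 * (int i - int i')) = (0::'a)" by (simp only: mult_eq_0_iff) blast
    then have "of_int (2 * int i) = (of_int (2 * int i') :: 'a)" by (simp add: algebra_simps)
    moreover have "\<bar>int i - int i'\<bar> \<le> int n" using assms by linarith
    ultimately show False using ne two_times_eq_iff[of "int i" "int i'"] by simp
  qed
qed simp

section \<open>The eigenspace decomposition\<close>

text \<open>
  Below the middle level, \<open>\<partial> f\<close> is lifted back along \<open>\<epsilon>\<close> (dividing by the eigenvalues); the difference
  is killed by \<open>\<partial>\<close> and is the new eigenvector. Above the middle the eigenvalue \<open>0\<close> would obstruct this,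
  so there the roles of \<open>\<epsilon>\<close> and \<open>\<partial>\<close> are exchanged and the induction descends from level \<open>n\<close>.
\<close>

lemma E2_decomp_low:
  assumes "r \<le> n - (j + r)" "j + r \<le> n" "f \<in> E2 n (j + r) j"
  shows "\<exists>g. (\<forall>i\<le>r. g i \<in> E3 n (j + r) j i) \<and> (f :: 'a chain) = (\<Sum>i\<le>r. g i)"
  using assms
proof (induction r arbitrary: f)
  case 0
  have f: "f \<in> E2 n j j" using 0 by simp
  have "bd n (eps n f) = scale (of_int (eigenvalue n j j 0)) f"
    unfolding E2_commutator[OF f] using E2_bd_bottom[OF _ f] 0
    by (simp add: linear_map_0[OF linear_eps] eigenvalue_def)
  then show ?case using f by (intro exI[of _ "\<lambda>_. f"]) (simp add: E3_iff)
next
  case (Suc r)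
  let ?s = "j + r"
  have s: "j \<le> n" "?s < n" and f: "f \<in> E2 n (Suc ?s) j" using Suc.prems by auto
  obtain g where g: "\<And>i. i \<le> r \<Longrightarrow> g i \<in> E3 n ?s j i" and sum: "bd n f = (\<Sum>i\<le>r. g i)"
  proof -
    have "r \<le> n - (j + r)" "j + r \<le> n" using Suc.prems by linarith+
    then show ?thesis using Suc.IH[OF _ _ E2_bd[OF s f]] that by blast
  qed
  define e where "e i = scale (1 / of_int (eigenvalue n ?s j i)) (eps n (g i))" for i
  have e: "e i \<in> E3 n (Suc ?s) j i" if "i \<le> r" for i
    unfolding e_def by (rule chain.subspace_scale[OF subspace_E3 E3_eps[OF s g[OF that]]])
  have be: "bd n (e i) = g i" if "i \<le> r" for i
  proof -
    \<comment> \<open>The position below the middle enters here: i \<le> r and j + 2r + 2 \<le> n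
      give j + r < n - i.\<close>
    have "of_int (eigenvalue n ?s j i) \<noteq> (0::'a)" using that Suc.prems by (intro eigenvalue_neq_0) auto
    then show ?thesis using g[OF that]
      by (simp add: e_def linear_map_scale[OF linear_bd] E3_iff)
  qed
  define h where "h = f - (\<Sum>i\<le>r. e i)"
  have "h \<in> E2 n (Suc ?s) j"
    unfolding h_def using f e
    by (intro chain.subspace_diff chain.subspace_sum subspace_E2) (auto simp: E3_iff)
  moreover have "bd n h = 0"
  proof -
    have "(\<Sum>i\<le>r. bd n (e i)) = (\<Sum>i\<le>r. g i)" using be by (intro sum.cong) auto
    then show ?thesis
      unfolding h_def linear_map_diff[OF linear_bd] linear_map_sum[OF linear_bd] sum by (simp only: diff_self)
  qed
  \<comment> \<open>For the new label r + 1 on level j + r + 1 the factor k - j + 1 - i of the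
    eigenvalue is 1, and the rest is the commutator scalar; so a vector killed by \<open>bd\<close>
    carries this label.\<close>
  moreover have "2 * (int n + int j - 2 * int (Suc ?s)) = eigenvalue n (Suc ?s) j (Suc r)"
    by (simp add: eigenvalue_def)
  ultimately have h: "h \<in> E3 n (Suc ?s) j (Suc r)"
    unfolding E3_iff using E2_commutator[of h n "Suc ?s" j] by (simp add: linear_map_0[OF linear_eps])
  have "(\<Sum>i\<le>r. if i \<le> r then e i else h) = (\<Sum>i\<le>r. e i)" by (intro sum.cong) auto
  then have "f = (\<Sum>i\<le>Suc r. if i \<le> r then e i else h)"
    unfolding sum.atMost_Suc by (simp add: h_def)
  then show ?case
    using e h by (intro exI[of _ "\<lambda>i. if i \<le> r then e i else h"]) (auto simp: le_Suc_eq)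
qed

lemma E2_decomp_high:
  assumes "n = s + q" "j + q \<le> s" "f \<in> E2 n s j"
  shows "\<exists>g. (\<forall>i\<le>q. g i \<in> E3 n s j i) \<and> (f :: 'a chain) = (\<Sum>i\<le>q. g i)"
  using assms
proof (induction q arbitrary: f s)
  case 0
  then have "eps n f = 0" using E2_top[of f n j] by simp
  then have "f \<in> E3 n s j 0"
    using 0 by (simp add: E3_iff linear_map_0[OF linear_bd] eigenvalue_def)
  then show ?case by (intro exI[of _ "\<lambda>_. f"]) simp
next
  case (Suc q)
  have s: "j \<le> n" "s < n" and f: "f \<in> E2 n s j" using Suc.prems by auto
  obtain g where g: "\<And>i. i \<le> q \<Longrightarrow> g i \<in> E3 n (Suc s) j i" and sum: "eps n f = (\<Sum>i\<le>q. g i)"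
    using Suc.IH[OF _ _ E2_eps[OF s f]] Suc.prems by auto
  define e where "e i = scale (1 / of_int (eigenvalue n s j i)) (bd n (g i))" for i
  have e: "e i \<in> E3 n s j i" if "i \<le> q" for i
    unfolding e_def by (rule chain.subspace_scale[OF subspace_E3 E3_bd(1)[OF s g[OF that]]])
  have be: "eps n (e i) = g i" if "i \<le> q" for i
  proof -
    have "of_int (eigenvalue n s j i) \<noteq> (0::'a)" using that Suc.prems by (intro eigenvalue_neq_0) auto
    then show ?thesis
      by (simp add: e_def linear_map_scale[OF linear_eps] E3_bd(2)[OF s g[OF that]])
  qed
  define h where "h = f - (\<Sum>i\<le>q. e i)"
  have "h \<in> E2 n s j"
    unfolding h_def using f e
    by (intro chain.subspace_diff chain.subspace_sum subspace_E2) (auto simp: E3_iff)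
  moreover have "eps n h = 0"
  proof -
    have "(\<Sum>i\<le>q. eps n (e i)) = (\<Sum>i\<le>q. g i)" using be by (intro sum.cong) auto
    then show ?thesis
      unfolding h_def linear_map_diff[OF linear_eps] linear_map_sum[OF linear_eps] sum by (simp only: diff_self)
  qed
  \<comment> \<open>The new label is q + 1 = n - s, where the factor n - s - i vanishes; so a vector
    killed by \<open>eps\<close> carries this label.\<close>
  moreover have "eigenvalue n s j (Suc q) = 0"
    using Suc.prems(1) by (simp add: eigenvalue_def)
  ultimately have h: "h \<in> E3 n s j (Suc q)"
    by (simp add: E3_iff linear_map_0[OF linear_bd])
  have "(\<Sum>i\<le>q. if i \<le> q then e i else h) = (\<Sum>i\<le>q. e i)" by (intro sum.cong) auto
  then have "f = (\<Sum>i\<le>Suc q. if i \<le> q then e i else h)"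
    unfolding sum.atMost_Suc by (simp add: h_def)
  then show ?case
    using e h by (intro exI[of _ "\<lambda>i. if i \<le> q then e i else h"]) (auto simp: le_Suc_eq)
qed

lemma E2_decomp:
  assumes "j \<le> s" "s \<le> n" "f \<in> E2 n s j"
  shows "\<exists>g. (\<forall>i\<le>min (s - j) (n - s). g i \<in> E3 n s j i) \<and> (f :: 'a chain) = (\<Sum>i\<le>min (s - j) (n - s). g i)"
proof (cases "s - j \<le> n - s")
  case True
  then show ?thesis using E2_decomp_low[of "s - j" j f] assms by (simp add: min_absorb1)
next
  case False
  then show ?thesis using E2_decomp_high[of s "n - s" j f] assms by (simp add: min_absorb2)
qed

text \<open>
  The second bound on \<open>i\<close> keeps the
  eigenvalue distinct from those that occur, since it is symmetric under \<open>i \<mapsto> n - j + 1 - i\<close>.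
\<close>

lemma E3_eq_0:
  assumes "j \<le> s" "s \<le> n" "min (s - j) (n - s) < i" "i + min (s - j) (n - s) \<le> n - j" "f \<in> E3 n s j i"
  shows "(f :: 'a chain) = 0"
proof -
  define N where "N = min (s - j) (n - s)"
  have N: "N < i" "i + N \<le> n - j" using assms(3,4) by (simp_all add: N_def)
  have f: "f \<in> E2 n s j" "nu_plus n f = scale (of_int (eigenvalue n s j i)) f"
    using assms(5) by (simp_all add: E3_iff nu_plus_def)
  obtain g where g: "\<And>i. i \<le> N \<Longrightarrow> g i \<in> E3 n s j i" and sum: "f = (\<Sum>i\<le>N. g i)"
    using E2_decomp[OF assms(1,2) f(1)] unfolding N_def by blast
  \<comment> \<open>The index i is added with component 0. Since the eigenvalues of all these
    indices are distinct, f must equal that component.\<close>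
  define v where "v = g (i := 0)"
  have "f = v i"
  proof (rule eigen_component[OF linear_nu_plus, where I = "insert i {..N}" and v = v
      and l = "\<lambda>i. of_int (eigenvalue n s j i)"])
    show "inj_on (\<lambda>i. of_int (eigenvalue n s j i) :: 'a) (insert i {..N})"
    proof (rule inj_onI)
      fix t t' assume *: "t \<in> insert i {..N}" "t' \<in> insert i {..N}"
        "of_int (eigenvalue n s j t) = (of_int (eigenvalue n s j t') :: 'a)"
      then consider "t = t'" | "t + t' \<le> n - j" using N by auto
      then show "t = t'" using eigenvalue_eq_iff[of t t' j s] * assms(1,2) by cases auto
    qed
    have "(\<Sum>t\<in>insert i {..N}. v t) = v i + (\<Sum>t\<le>N. v t)" using N by simp
    also have "(\<Sum>t\<le>N. v t) = (\<Sum>t\<le>N. g t)" using N by (intro sum.cong) (auto simp: v_def)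
    finally show "f = (\<Sum>t\<in>insert i {..N}. v t)" unfolding sum v_def by simp
    fix t assume t: "t \<in> insert i {..N}"
    show "nu_plus n (v t) = scale (of_int (eigenvalue n s j t)) (v t)"
    proof (cases "t = i")
      case True
      then have "v t = 0" by (simp add: v_def)
      then show ?thesis by (simp only: linear_map_0[OF linear_nu_plus] chain.scale_zero_right)
    next
      case False
      then have "v t = g t" "t \<le> N" using t by (auto simp: v_def)
      then show ?thesis using g[of t] by (simp add: E3_iff nu_plus_def)
    qed
  qed (use f in auto)
  then show ?thesis by (simp add: v_def)
qed

text \<open>Let i > 0. If 2i \<le> n - j, the image has label i on level j + i - 1, where labels
  stop at i - 1, so \<open>E3_eq_0\<close> applies to it. Otherwise the chain of levels from j + i
  to n - i is empty and f itself is 0.\<close>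

lemma E3_bd_bottom:
  assumes "j \<le> n" "i \<le> n - j" "f \<in> E3 n (j + i) j i"
  shows "bd n (f :: 'a chain) = 0"
proof (cases i)
  case 0
  then show ?thesis using assms E2_bd_bottom by (simp add: E3_iff)
next
  case (Suc i')
  show ?thesis
  proof (cases "2 * i \<le> n - j")
    case True
    have "bd n f \<in> E3 n (j + i') j i" using assms Suc by (intro E3_bd) auto
    then show ?thesis
      using True Suc assms by (intro E3_eq_0[of j "j + i'" i]) auto
  next
    case False
    then have "f = 0" using assms Suc by (intro E3_eq_0[of j "j + i" i]) auto
    then show ?thesis by (simp add: linear_map_0[OF linear_bd])
  qed
qed

text \<open>Mirror image of the lower end: if 2i \<le> n - j, labels on level n - i + 1 stop at i -
  1; otherwise f itself is 0.\<close>

lemma E3_eps_top: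
  assumes "j \<le> n" "i \<le> n - j" "f \<in> E3 n (n - i) j i"
  shows "eps n (f :: 'a chain) = 0"
proof (cases i)
  case 0
  then show ?thesis using assms E2_top[of f n j] by (simp add: E3_iff)
next
  case (Suc i')
  show ?thesis
  proof (cases "2 * i \<le> n - j")
    case True
    have "eps n f \<in> E3 n (Suc (n - i)) j i" using assms Suc by (intro E3_eps) auto
    moreover have "Suc (n - i) = n - i'" using assms Suc by simp
    ultimately show ?thesis
      using True Suc assms by (intro E3_eq_0[of j "n - i'" i]) auto
  next
    case False
    then have "f = 0" using assms Suc by (intro E3_eq_0[of j "n - i" i]) auto
    then show ?thesis by (simp add: linear_map_0[OF linear_eps])
  qed
qed

end


section \<open>Fixed points of a subgroup\<close>

lemma subspace_fixed: "chain.subspace N \<Longrightarrow> chain.subspace (fixed n G (N :: 'a::field chain set))"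
  unfolding chain.subspace_def fixed_def
  by (simp add: linear_map_0[OF linear_act] linear_map_add[OF linear_act] linear_map_scale[OF linear_act])

context large_characteristic
begin

text \<open>T has to separate the indices j before \<open>nu_plus\<close> separates the indices i:
  eigenvalues of \<open>nu_plus\<close> may coincide for different j, for example at (j, i) = (0, 1)
  and (2, 0) when n = 4 and k = 2.\<close>

lemma E3_indep:
  fixes v :: "nat \<Rightarrow> nat \<Rightarrow> 'a chain"
  assumes "k \<le> n" "\<And>j i. j \<le> k \<Longrightarrow> i \<le> min (k - j) (n - k) \<Longrightarrow> v j i \<in> E3 n k j i"
    "(\<Sum>j\<le>k. \<Sum>i\<le>min (k - j) (n - k). v j i) = 0" "j \<le> k" "i \<le> min (k - j) (n - k)"
  shows "v j i = 0"
proof -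
  have "(\<Sum>i\<le>min (k - j) (n - k). v j i) = 0"
  proof (rule eigen_indep[OF linear_flip_sum, where I = "{..k}" and v = "\<lambda>j. \<Sum>i\<le>min (k - j) (n - k). v j i"
        and l = "\<lambda>j. of_int (int n - 2 * int j)"])
    show "inj_on (\<lambda>j. of_int (int n - 2 * int j) :: 'a) {..k}"
      by (rule inj_on_subset[OF inj_flip_eigenvalue]) (use assms(1) in auto)
    fix j assume "j \<in> {..k}"
    then have "(\<Sum>i\<le>min (k - j) (n - k). v j i) \<in> E2 n k j"
      using assms(2) by (intro chain.subspace_sum subspace_E2) (auto simp: E3_iff)
    then show "flip_sum n (\<Sum>i\<le>min (k - j) (n - k). v j i)
        = scale (of_int (int n - 2 * int j)) (\<Sum>i\<le>min (k - j) (n - k). v j i)"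
      using E2_subset by blast
  qed (use assms in auto)
  then show ?thesis
  proof (rule eigen_indep[OF linear_nu_plus, where I = "{..min (k - j) (n - k)}" and v = "v j"
        and l = "\<lambda>i. of_int (eigenvalue n k j i)", rotated 3])
    show "inj_on (\<lambda>i. of_int (eigenvalue n k j i) :: 'a) {..min (k - j) (n - k)}"
    proof (rule inj_onI)
      fix i i' assume *: "i \<in> {..min (k - j) (n - k)}" "i' \<in> {..min (k - j) (n - k)}"
        "of_int (eigenvalue n k j i) = (of_int (eigenvalue n k j i') :: 'a)"
      \<comment> \<open>One label is bounded by k - j and the other by n - k, which add up to n -
        j.\<close>
      then have "i + i' \<le> n - j" using assms(1,4) by auto
      then show "i = i'" using eigenvalue_eq_iff[of i i' j k] * assms(1,4) by auto
    qed
  qed (use assms(2)[of j] assms(4,5) in \<open>auto simp: E3_iff nu_plus_def\<close>)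
qed

lemma direct_sum_fixed:
  assumes G: "subgroup G (hyperoct n)" and k: "k \<le> n"
  shows "is_direct_sum {(j, i). j \<le> k \<and> i \<le> min (k - j) (n - k)}
    (\<lambda>(j, i). fixed n G (E3 n k j i)) (fixed n G (M n k :: 'a chain set))"
proof -
  let ?N = "\<lambda>j. min (k - j) (n - k)"
  let ?F = "\<lambda>(j, i). fixed n G (E3 n k j i :: 'a chain set)"
  let ?I = "{(j, i). j \<le> k \<and> i \<le> ?N j}"
  have I: "?I = (SIGMA j:{..k}. {..?N j})" by auto
  have sum_I: "(\<Sum>t\<in>?I. v t) = (\<Sum>j\<le>k. \<Sum>i\<le>?N j. v (j, i))" for v :: "nat \<times> nat \<Rightarrow> 'a chain"
    unfolding I by (simp add: sum.Sigma)
  have indep: "v (j, i) = 0" if "\<And>j i. (j, i) \<in> ?I \<Longrightarrow> v (j, i) \<in> E3 n k j i" "(\<Sum>t\<in>?I. v t) = 0"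
    "(j, i) \<in> ?I" for v :: "nat \<times> nat \<Rightarrow> 'a chain" and j i
    using E3_indep[OF k, of "\<lambda>j i. v (j, i)" j i] that unfolding sum_I by simp
  have GB: "g \<in> carrier (hyperoct n)" if "g \<in> G" for g
    using subgroup.mem_carrier[OF G that] .
  have sub: "chain.subspace (?F t)" for t
    by (cases t) (simp add: subspace_fixed subspace_E3)
  have "fixed n G (M n k) = {\<Sum>t\<in>?I. v t | v. \<forall>t\<in>?I. v t \<in> ?F t}"
    (is "_ = ?S")
  proof (intro equalityI subsetI)
    fix f :: "'a chain" assume f: "f \<in> fixed n G (M n k)"
    then have "f \<in> M n k" by (simp add: fixed_def)
    then obtain u where u: "\<And>j. j \<le> k \<Longrightarrow> u j \<in> E2 n k j" "f = (\<Sum>j\<le>k. u j)"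
      using M_decomp by blast
    have "\<forall>j\<in>{..k}. \<exists>h. (\<forall>i\<le>?N j. h i \<in> E3 n k j i) \<and> u j = (\<Sum>i\<le>?N j. h i)"
      using E2_decomp u(1) k by auto
    then obtain h where h: "\<And>j i. j \<le> k \<Longrightarrow> i \<le> ?N j \<Longrightarrow> h j i \<in> E3 n k j i"
      "\<And>j. j \<le> k \<Longrightarrow> u j = (\<Sum>i\<le>?N j. h j i)"
      by (auto simp: bchoice_iff)
    define v where "v t = h (fst t) (snd t)" for t
    have v: "v (j, i) \<in> E3 n k j i" if "(j, i) \<in> ?I" for j i
      using h(1) that by (simp add: v_def)
    have fv: "f = (\<Sum>t\<in>?I. v t)" unfolding u(2) sum_I v_def using h(2) by simp
    have "act n g (v (j, i)) = v (j, i)" if g: "g \<in> G" and ji: "(j, i) \<in> ?I" for g j i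
    proof -
      \<comment> \<open>The defect of invariance, component by component. It stays in the same
        eigenspaces and its sum is \<open>act n g f - f\<close>, which is 0.\<close>
      define w where "w t = act n g (v t) - v t" for t
      have "w (j, i) = 0"
      proof (rule indep[OF _ _ ji])
        fix j i assume ji: "(j, i) \<in> ?I"
        then have "act n g (v (j, i)) \<in> E3 n k j i" using v k GB[OF g] by (intro E3_act) auto
        then show "w (j, i) \<in> E3 n k j i"
          unfolding w_def by (rule chain.subspace_diff[OF subspace_E3 _ v[OF ji]])
      next
        have "(\<Sum>t\<in>?I. w t) = act n g f - f"
          unfolding w_def sum_subtractf fv linear_map_sum[OF linear_act] ..
        also have "\<dots> = 0" using f g by (simp add: fixed_def)
        finally show "(\<Sum>t\<in>?I. w t) = 0" .
      qed
      then show ?thesis unfolding w_def by (simp only: right_minus_eq)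
    qed
    then have "\<forall>t\<in>?I. v t \<in> ?F t"
      using v by (auto simp: fixed_def)
    then show "f \<in> ?S" using fv by blast
  next
    fix f :: "'a chain" assume "f \<in> ?S"
    then obtain v where "f = (\<Sum>t\<in>?I. v t)" and v: "\<forall>t\<in>?I. v t \<in> ?F t"
      by blast
    moreover have "v t \<in> fixed n G (M n k)" if "t \<in> ?I" for t
      using v that by (auto simp: fixed_def E3_iff dest: E2_M)
    ultimately show "f \<in> fixed n G (M n k)"
      by (auto intro!: chain.subspace_sum subspace_fixed subspace_M)
  qed
  moreover have "\<forall>t\<in>?I. v t = 0" if "\<forall>t\<in>?I. v t \<in> ?F t"
    "(\<Sum>t\<in>?I. v t) = 0" for v :: "nat \<times> nat \<Rightarrow> 'a chain"
  proof
    fix t assume t: "t \<in> ?I"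
    have "v (j, i) \<in> E3 n k j i" if "(j, i) \<in> ?I" for j i
      using bspec[OF \<open>\<forall>t\<in>?I. _ t\<close> that] by (simp add: fixed_def)
    then show "v t = 0" using indep[of v "fst t" "snd t"] that(2) t by simp
  qed
  ultimately show ?thesis unfolding is_direct_sum_def using sub by blast
qed

text \<open>Both composites are multiplication by the same nonzero eigenvalue, so each map divided
  by it inverts the other; commuting with G keeps both maps inside the fixed points.\<close>

lemma fixed_iso:
  assumes G: "subgroup G (hyperoct n)" and s: "j \<le> n" "j + i \<le> s" "s < n - i"
  shows "restricts_to_iso (eps n) (fixed n G (E3 n s j i :: 'a chain set)) (fixed n G (E3 n (Suc s) j i))"
    "restricts_to_iso (bd n) (fixed n G (E3 n (Suc s) j i :: 'a chain set)) (fixed n G (E3 n s j i))"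
proof -
  let ?U = "fixed n G (E3 n s j i :: 'a chain set)" and ?W = "fixed n G (E3 n (Suc s) j i :: 'a chain set)"
  let ?c = "of_int (eigenvalue n s j i) :: 'a"
  have sn: "s < n" using s by simp
  have c: "?c \<noteq> 0" using eigenvalue_neq_0 s by simp
  have GB: "g \<in> carrier (hyperoct n)" if "g \<in> G" for g
    using subgroup.mem_carrier[OF G that] .
  have U: "chain.subspace ?U" and W: "chain.subspace ?W"
    by (simp_all add: subspace_fixed subspace_E3)
  have e: "eps n f \<in> ?W" if "f \<in> ?U" for f
    using that E3_eps[OF s(1) sn] by (auto simp: fixed_def act_eps[OF GB])
  have b: "bd n f \<in> ?U" if "f \<in> ?W" for f
    using that E3_bd(1)[OF s(1) sn] by (auto simp: fixed_def act_bd[OF GB])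
  have be: "bd n (eps n f) = scale ?c f" if "f \<in> ?U" for f
    using that by (simp add: fixed_def E3_iff)
  have eb: "eps n (bd n f) = scale ?c f" if "f \<in> ?W" for f
    using that E3_bd(2)[OF s(1) sn] by (simp add: fixed_def)
  have "bij_betw (eps n) ?U ?W"
    by (rule bij_betw_byWitness[where f' = "\<lambda>f. scale (1 / ?c) (bd n f)"])
      (use c in \<open>auto simp: linear_map_scale[OF linear_eps] be eb intro: e b chain.subspace_scale[OF U]\<close>)
  then show "restricts_to_iso (eps n) ?U ?W"
    by (simp add: restricts_to_iso_def linear_eps U W)
  have "bij_betw (bd n) ?W ?U"
    by (rule bij_betw_byWitness[where f' = "\<lambda>f. scale (1 / ?c) (eps n f)"])
      (use c in \<open>auto simp: linear_map_scale[OF linear_bd] be eb intro: e b chain.subspace_scale[OF W]\<close>)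
  then show "restricts_to_iso (bd n) ?W ?U"
    by (simp add: restricts_to_iso_def linear_bd U W)
qed

lemma fixed_ends:
  assumes "j \<le> n" "i \<le> n - j"
  shows "bd n ` fixed n G (E3 n (j + i) j i :: 'a chain set) = {0}"
    "eps n ` fixed n G (E3 n (n - i) j i :: 'a chain set) = {0}"
proof -
  have z: "0 \<in> fixed n G (E3 n s j i :: 'a chain set)" for s
    by (rule chain.subspace_0[OF subspace_fixed[OF subspace_E3]])
  have "bd n f = 0" if "f \<in> fixed n G (E3 n (j + i) j i :: 'a chain set)" for f
    using that E3_bd_bottom[OF assms] by (simp add: fixed_def)
  then show "bd n ` fixed n G (E3 n (j + i) j i :: 'a chain set) = {0}"
    using z by (auto intro!: image_eqI[of _ _ 0])
  have "eps n f = 0" if "f \<in> fixed n G (E3 n (n - i) j i :: 'a chain set)" for f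
    using that E3_eps_top[OF assms] by (simp add: fixed_def)
  then show "eps n ` fixed n G (E3 n (n - i) j i :: 'a chain set) = {0}"
    using z by (auto intro!: image_eqI[of _ _ 0])
qed

end

text \<open>A positive x \<le> n exists only for n \<ge> 1, and then 2 could vanish in the field
  only for n = 1 in characteristic 2.\<close>

lemma large_characteristicI:
  assumes char: "CHAR('a::field) = 0 \<or> n < CHAR('a)" and "\<not> (n = 1 \<and> CHAR('a) = 2)"
  shows "large_characteristic TYPE('a) n"
proof
  fix x :: int assume x: "0 < x" "x \<le> int n"
  have neq: "of_nat m \<noteq> (0::'a)" if "0 < m" "CHAR('a) = 0 \<or> m < CHAR('a)" for m
    using that by (auto simp: of_nat_eq_0_iff_char_dvd dest: dvd_imp_le)
  have "of_int x = (of_nat (nat x) :: 'a)" using x by simp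
  moreover have "CHAR('a) = 0 \<or> nat x < CHAR('a)" using x char by linarith
  ultimately have "of_int x \<noteq> (0::'a)" using neq[of "nat x"] x(1) by simp
  moreover have "of_nat 2 \<noteq> (0::'a)" using x assms by (intro neq) auto
  ultimately show "of_int (2 * x) \<noteq> (0::'a)" by simp
qed

theorem theorem4p2:
  fixes n k :: nat and G :: "(vertex \<Rightarrow> vertex) set"
  assumes char: "CHAR('a::field) = 0 \<or> n < CHAR('a)"
    and not_degenerate: "\<not> (n = 1 \<and> CHAR('a) = 2)"
    and G: "subgroup G (hyperoct n)"
    and k: "k \<le> n"
  shows "is_direct_sum {(j, i). j \<le> k \<and> i \<le> min (k - j) (n - k)}
           (\<lambda>(j, i). fixed n G (E3 n k j i)) (fixed n G (M n k :: 'a chain set)) \<and>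
         (\<forall>j\<le>n. \<forall>i\<le>n - j.
           (\<forall>s. j + i \<le> s \<and> s < n - i \<longrightarrow>
              restricts_to_iso (eps n)
                (fixed n G (E3 n s j i :: 'a chain set)) (fixed n G (E3 n (s + 1) j i)) \<and>
              restricts_to_iso (bd n)
                (fixed n G (E3 n (s + 1) j i :: 'a chain set)) (fixed n G (E3 n s j i))) \<and>
           bd n ` fixed n G (E3 n (j + i) j i :: 'a chain set) = {0} \<and>
           eps n ` fixed n G (E3 n (n - i) j i :: 'a chain set) = {0})"
proof -
  interpret large_characteristic n "TYPE('a)"
    using large_characteristicI[OF char not_degenerate] .
  show ?thesis
    by (intro conjI allI impI direct_sum_fixed[OF G k] fixed_iso[OF G, unfolded Suc_eq_plus1] fixed_ends)
      auto
qed

end
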